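(* Let $G$ be a nontrivial trivial-units-only group (for example, a nontrivial group satisfying the unique product property). Let $R$ be a commutative unital ring and let $c$ be an $R^\times$-valued normalised $2$-cocycle on $G$. Then the twisted group ring $R(G,c)$ has no nontrivial units if and only if $R$ is reduced and indecomposable.
   Context: For a commutative unital ring $R$ with unit group $R^\times$ and a group $G$ with identity $e$, a normalised $R^\times$-valued $2$-cocycle is a map $c\colon G\times G\to R^\times$ with $c(\alpha,\beta)c(\alpha\beta,\gamma)=c(\alpha,\beta\gamma)c(\beta,\gamma)$ and $c(e,\gamma)=c(\gamma,e)=1$. The twisted group ring $R(G,c)$ is the $R$-algebra of finitely supported functions $f\colon G\to R$ with product $(f*g)(\beta)=\sum_{\alpha\in G}c(\alpha,\alpha^{-1}\beta)f(\alpha)g(\alpha^{-1}\beta)$, i.e. $\delta_g\delta_h=c(g,h)\delta_{gh}$ for point masses; its identity is $\delta_e$. Its trivial units are the elements $t\delta_g$ with $t\in R^\times$, $g\in G$; it has no nontrivial units if every unit is of this form. $G$ is a trivial-units-only group if $k(G,c)$ has no nontrivial units for every field $k$ and every normalised $k^\times$-valued $2$-cocycle $c$ on $G$. $G$ has the unique product property if for any finite nonempty $A,B\subseteq G$ some element of $AB$ can be written uniquely as $ab$ with $a\in A$, $b\in B$. $R$ is reduced if it has no nonzero nilpotent elements, and indecomposable if its only idempotents are $0$ and $1$. *)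

theory Defs
  imports "HOL-Algebra.Algebra"
begin

definition normalised_cocycle ::
  "('r, 'm) ring_scheme \<Rightarrow> ('g, 'n) monoid_scheme \<Rightarrow> ('g \<Rightarrow> 'g \<Rightarrow> 'r) \<Rightarrow> bool" where
  "normalised_cocycle R G c \<longleftrightarrow>
     (\<forall>\<alpha>\<in>carrier G. \<forall>\<beta>\<in>carrier G. c \<alpha> \<beta> \<in> Units R) \<and>
     (\<forall>\<alpha>\<in>carrier G. \<forall>\<beta>\<in>carrier G. \<forall>\<gamma>\<in>carrier G.
        c \<alpha> \<beta> \<otimes>\<^bsub>R\<^esub> c (\<alpha> \<otimes>\<^bsub>G\<^esub> \<beta>) \<gamma> = c \<alpha> (\<beta> \<otimes>\<^bsub>G\<^esub> \<gamma>) \<otimes>\<^bsub>R\<^esub> c \<beta> \<gamma>) \<and>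
     (\<forall>\<gamma>\<in>carrier G. c \<one>\<^bsub>G\<^esub> \<gamma> = \<one>\<^bsub>R\<^esub> \<and> c \<gamma> \<one>\<^bsub>G\<^esub> = \<one>\<^bsub>R\<^esub>)"

definition supp ::
  "('r, 'm) ring_scheme \<Rightarrow> ('g, 'n) monoid_scheme \<Rightarrow> ('g \<Rightarrow> 'r) \<Rightarrow> 'g set" where
  "supp R G f = {\<alpha> \<in> carrier G. f \<alpha> \<noteq> \<zero>\<^bsub>R\<^esub>}"

text \<open>\<open>point_mass R G t g\<close> is the element \<open>t \<delta>\<^sub>g\<close>.\<close>

definition point_mass ::
  "('r, 'm) ring_scheme \<Rightarrow> ('g, 'n) monoid_scheme \<Rightarrow> 'r \<Rightarrow> 'g \<Rightarrow> 'g \<Rightarrow> 'r" where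
  "point_mass R G t g = (\<lambda>x\<in>carrier G. if x = g then t else \<zero>\<^bsub>R\<^esub>)"

text \<open>
  The product is a sum over the support of \<open>f\<close>, since \<^const>\<open>finsum\<close> is zero by convention
  on infinite index sets; the summands outside the support vanish.
\<close>

definition twisted_group_ring ::
  "('r, 'm) ring_scheme \<Rightarrow> ('g, 'n) monoid_scheme \<Rightarrow> ('g \<Rightarrow> 'g \<Rightarrow> 'r) \<Rightarrow> ('g \<Rightarrow> 'r) ring" where
  "twisted_group_ring R G c =
     \<lparr>carrier = {f \<in> carrier G \<rightarrow>\<^sub>E carrier R. finite (supp R G f)},
      monoid.mult = (\<lambda>f h. \<lambda>\<beta>\<in>carrier G. \<Oplus>\<^bsub>R\<^esub>\<alpha>\<in>supp R G f.
                c \<alpha> (inv\<^bsub>G\<^esub> \<alpha> \<otimes>\<^bsub>G\<^esub> \<beta>) \<otimes>\<^bsub>R\<^esub> f \<alpha> \<otimes>\<^bsub>R\<^esub> h (inv\<^bsub>G\<^esub> \<alpha> \<otimes>\<^bsub>G\<^esub> \<beta>)),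
      one = point_mass R G \<one>\<^bsub>R\<^esub> \<one>\<^bsub>G\<^esub>,
      ring.zero = (\<lambda>x\<in>carrier G. \<zero>\<^bsub>R\<^esub>),
      ring.add = (\<lambda>f h. \<lambda>x\<in>carrier G. f x \<oplus>\<^bsub>R\<^esub> h x)\<rparr>"

definition trivial_units ::
  "('r, 'm) ring_scheme \<Rightarrow> ('g, 'n) monoid_scheme \<Rightarrow> ('g \<Rightarrow> 'r) set" where
  "trivial_units R G = {point_mass R G t g | t g. t \<in> Units R \<and> g \<in> carrier G}"

definition no_nontrivial_units ::
  "('r, 'm) ring_scheme \<Rightarrow> ('g, 'n) monoid_scheme \<Rightarrow> ('g \<Rightarrow> 'g \<Rightarrow> 'r) \<Rightarrow> bool" where
  "no_nontrivial_units R G c \<longleftrightarrow> Units (twisted_group_ring R G c) \<subseteq> trivial_units R G"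

definition reduced_ring :: "('r, 'm) ring_scheme \<Rightarrow> bool" where
  "reduced_ring R \<longleftrightarrow>
     (\<forall>x\<in>carrier R. (\<exists>n::nat. x [^]\<^bsub>R\<^esub> n = \<zero>\<^bsub>R\<^esub>) \<longrightarrow> x = \<zero>\<^bsub>R\<^esub>)"

definition indecomposable_ring :: "('r, 'm) ring_scheme \<Rightarrow> bool" where
  "indecomposable_ring R \<longleftrightarrow>
     (\<forall>x\<in>carrier R. x \<otimes>\<^bsub>R\<^esub> x = x \<longrightarrow> x = \<zero>\<^bsub>R\<^esub> \<or> x = \<one>\<^bsub>R\<^esub>)"

definition unique_product_property :: "('g, 'n) monoid_scheme \<Rightarrow> bool" where
  "unique_product_property G \<longleftrightarrow>
     (\<forall>A B. finite A \<and> A \<noteq> {} \<and> A \<subseteq> carrier G \<and> finite B \<and> B \<noteq> {} \<and> B \<subseteq> carrier G \<longrightarrow>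
        (\<exists>x \<in> A <#>\<^bsub>G\<^esub> B. \<exists>!p. p \<in> A \<times> B \<and> x = fst p \<otimes>\<^bsub>G\<^esub> snd p))"

text \<open>
  HOL has no quantifier over types, so the fields here are those whose carrier is a subset of
  the fixed infinite type \<open>'g + nat\<close>. Nothing is lost: a unit, its inverse and the values
  of the cocycle lie in a subfield of cardinality at most that of \<open>'g + nat\<close>, and this yields
  \<open>trivial_units_only_imp_no_nontrivial_units\<close> below, for fields over arbitrary types.
\<close>

definition trivial_units_only :: "('g, 'n) monoid_scheme \<Rightarrow> bool" where
  "trivial_units_only G \<longleftrightarrow> group G \<and>
     (\<forall>(k :: ('g + nat) ring) c. field k \<and> normalised_cocycle k G c \<longrightarrow> no_nontrivial_units k G c)"

lemma supp_inj_hom: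
  assumes "ring R" "ring S" "h \<in> ring_hom R S" "inj_on h (carrier R)"
    and "u \<in> carrier G \<rightarrow> carrier R"
  shows "supp S G (\<lambda>x\<in>carrier G. h (u x)) = supp R G u"
proof -
  have "h \<zero>\<^bsub>R\<^esub> = \<zero>\<^bsub>S\<^esub>"
    using ring_hom_zero[OF assms(3,1,2)] .
  moreover have "h (u x) = h \<zero>\<^bsub>R\<^esub> \<longleftrightarrow> u x = \<zero>\<^bsub>R\<^esub>" if "x \<in> carrier G" for x
    using assms that by (auto simp: inj_on_eq_iff Pi_def ring.ring_simprules(2))
  ultimately show ?thesis
    unfolding supp_def by auto
qed

lemma twisted_mult_inj_hom:
  assumes "group G" "cring R" "cring S" "h \<in> ring_hom R S" "inj_on h (carrier R)"
    and c: "\<And>\<alpha> \<beta>. \<alpha> \<in> carrier G \<Longrightarrow> \<beta> \<in> carrier G \<Longrightarrow> c \<alpha> \<beta> \<in> carrier R"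
    and cd: "\<And>\<alpha> \<beta>. \<alpha> \<in> carrier G \<Longrightarrow> \<beta> \<in> carrier G \<Longrightarrow> d \<alpha> \<beta> = h (c \<alpha> \<beta>)"
    and u: "u \<in> carrier G \<rightarrow> carrier R" and v: "v \<in> carrier G \<rightarrow> carrier R"
  shows "(\<lambda>x\<in>carrier G. h (u x)) \<otimes>\<^bsub>twisted_group_ring S G d\<^esub> (\<lambda>x\<in>carrier G. h (v x))
       = (\<lambda>x\<in>carrier G. h ((u \<otimes>\<^bsub>twisted_group_ring R G c\<^esub> v) x))"
proof -
  interpret group G by fact
  interpret R: cring R by fact
  interpret S: cring S by fact
  interpret h: ring_hom_cring R S h
    by (intro ring_hom_cring.intro ring_hom_cring_axioms.intro) fact+
  have supp: "supp S G (\<lambda>x\<in>carrier G. h (u x)) = supp R G u"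
    using supp_inj_hom[OF R.ring_axioms S.ring_axioms assms(4,5) u] .
  have sub: "supp R G u \<subseteq> carrier G" by (auto simp: supp_def)
  show ?thesis
  proof (rule ext)
    fix \<beta>
    show "((\<lambda>x\<in>carrier G. h (u x)) \<otimes>\<^bsub>twisted_group_ring S G d\<^esub> (\<lambda>x\<in>carrier G. h (v x))) \<beta>
       = (\<lambda>x\<in>carrier G. h ((u \<otimes>\<^bsub>twisted_group_ring R G c\<^esub> v) x)) \<beta>"
    proof (cases "\<beta> \<in> carrier G")
      case True
      let ?F = "\<lambda>\<alpha>. c \<alpha> (inv\<^bsub>G\<^esub> \<alpha> \<otimes>\<^bsub>G\<^esub> \<beta>) \<otimes>\<^bsub>R\<^esub> u \<alpha> \<otimes>\<^bsub>R\<^esub> v (inv\<^bsub>G\<^esub> \<alpha> \<otimes>\<^bsub>G\<^esub> \<beta>)"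
      have F: "?F \<in> supp R G u \<rightarrow> carrier R"
        using sub u v c True by (auto simp: Pi_def subset_iff)
      have "h (\<Oplus>\<^bsub>R\<^esub>\<alpha>\<in>supp R G u. ?F \<alpha>) = (\<Oplus>\<^bsub>S\<^esub>\<alpha>\<in>supp R G u. (h \<circ> ?F) \<alpha>)"
        using h.hom_finsum[OF F] by (simp add: comp_def)
      also have "\<dots> = (\<Oplus>\<^bsub>S\<^esub>\<alpha>\<in>supp R G u. d \<alpha> (inv\<^bsub>G\<^esub> \<alpha> \<otimes>\<^bsub>G\<^esub> \<beta>) \<otimes>\<^bsub>S\<^esub>
            (\<lambda>x\<in>carrier G. h (u x)) \<alpha> \<otimes>\<^bsub>S\<^esub> (\<lambda>x\<in>carrier G. h (v x)) (inv\<^bsub>G\<^esub> \<alpha> \<otimes>\<^bsub>G\<^esub> \<beta>))"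
        using sub u v c True
        by (intro S.finsum_cong') (auto simp: Pi_def subset_iff cd)
      finally show ?thesis
        using True by (simp add: twisted_group_ring_def supp)
    qed (simp add: twisted_group_ring_def)
  qed
qed

lemma card_generate_field:
  fixes k :: "('k, 'm) ring_scheme"
  assumes "infinite (UNIV :: 'u set)" "|S| \<le>o |UNIV :: 'u set|"
  shows "|generate_field k S| \<le>o |UNIV :: 'u set|"
proof -
  let ?r = "|UNIV :: 'u set|"
  define step where "step U = U \<union> a_inv k ` U \<union> m_inv k ` U \<union>
      (\<lambda>(x, y). x \<oplus>\<^bsub>k\<^esub> y) ` (U \<times> U) \<union> (\<lambda>(x, y). x \<otimes>\<^bsub>k\<^esub> y) ` (U \<times> U)" for U
  define T where "T n = (step ^^ n) (insert \<one>\<^bsub>k\<^esub> S)" for n :: nat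
  have r: "infinite (Field ?r)" "Card_order ?r"
    using assms(1) by (auto simp: Field_card_of card_of_Card_order)
  have un: "|U \<union> V| \<le>o ?r"
    if "|U| \<le>o ?r" "|V| \<le>o ?r" for U V :: "'k set"
    using card_of_Un_ordLeq_infinite_Field[OF r(1) that r(2)] .
  have one: "|{\<one>\<^bsub>k\<^esub>}| \<le>o ?r"
    by (intro card_of_ordLeq[THEN iffD1]) auto
  have card_T: "|T n| \<le>o ?r" for n
  proof (induction n)
    case 0
    show ?case unfolding T_def using un[OF one assms(2)] by simp
  next
    case (Suc n)
    have "|T n \<times> T n| \<le>o ?r"
      using card_of_Times_ordLeq_infinite_Field[OF r(1) Suc.IH Suc.IH r(2)] .
    hence "|step (T n)| \<le>o ?r"
      unfolding step_def
      by (intro un Suc.IH card_of_image[THEN ordLeq_transitive])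
    thus ?case by (simp add: T_def)
  qed
  have mono: "T m \<subseteq> T n" if "m \<le> n" for m n
    using that by (rule lift_Suc_mono_le[rotated]) (auto simp: T_def step_def)
  have Suc: "T (Suc n) = step (T n)" for n by (simp add: T_def)
  have pair: "\<exists>n. a \<in> T n \<and> b \<in> T n" if "a \<in> T i" "b \<in> T j" for a b i j
    using that mono[of i "max i j"] mono[of j "max i j"] by (intro exI[of _ "max i j"]) auto
  have "h \<in> (\<Union>n. T n)" if "h \<in> generate_field k S" for h
    using that
  proof induction
    case one
    have "\<one>\<^bsub>k\<^esub> \<in> T 0" by (simp add: T_def)
    thus ?case by blast
  next
    case (incl h)
    hence "h \<in> T 0" by (simp add: T_def)
    thus ?case by blast
  next
    case (a_inv h)
    then obtain n where "h \<in> T n" by blast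
    hence "\<ominus>\<^bsub>k\<^esub> h \<in> T (Suc n)" unfolding Suc step_def by blast
    thus ?case by blast
  next
    case (m_inv h)
    then obtain n where "h \<in> T n" by blast
    hence "inv\<^bsub>k\<^esub> h \<in> T (Suc n)" unfolding Suc step_def by blast
    thus ?case by blast
  next
    case (eng_add h1 h2)
    then obtain n where "h1 \<in> T n" "h2 \<in> T n" using pair by blast
    hence "h1 \<oplus>\<^bsub>k\<^esub> h2 \<in> T (Suc n)" unfolding Suc step_def by blast
    thus ?case by blast
  next
    case (eng_mult h1 h2)
    then obtain n where "h1 \<in> T n" "h2 \<in> T n" using pair by blast
    hence "h1 \<otimes>\<^bsub>k\<^esub> h2 \<in> T (Suc n)" unfolding Suc step_def by blast
    thus ?case by blast
  qed
  hence "generate_field k S \<subseteq> (\<Union>n. T n)" by blast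
  moreover have "|\<Union>n. T n| \<le>o ?r"
  proof (rule card_of_UNION_ordLeq_infinite[OF assms(1)])
    show "|UNIV :: nat set| \<le>o ?r"
      using assms(1) infinite_iff_card_of_nat by blast
  qed (use card_T in blast)
  ultimately show ?thesis
    using card_of_mono1 ordLeq_transitive by blast
qed

theorem trivial_units_only_imp_no_nontrivial_units:
  fixes G :: "('g, 'n) monoid_scheme" and k :: "('k, 'm) ring_scheme"
  assumes G: "trivial_units_only G" and "field k" and c: "normalised_cocycle k G c"
  shows "no_nontrivial_units k G c"
proof -
  interpret group G using G by (simp add: trivial_units_only_def)
  interpret k: field k by fact
  have cU: "c \<alpha> \<beta> \<in> Units k" and cC: "c \<alpha> \<beta> \<in> carrier k"
    if "\<alpha> \<in> carrier G" "\<beta> \<in> carrier G" for \<alpha> \<beta>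
    using c that by (auto simp: normalised_cocycle_def)
  have "u \<in> trivial_units k G" if "u \<in> Units (twisted_group_ring k G c)" for u
  proof -
    from that obtain v where
      u: "u \<in> carrier (twisted_group_ring k G c)" and v: "v \<in> carrier (twisted_group_ring k G c)"
      and vu: "v \<otimes>\<^bsub>twisted_group_ring k G c\<^esub> u = \<one>\<^bsub>twisted_group_ring k G c\<^esub>"
      and uv: "u \<otimes>\<^bsub>twisted_group_ring k G c\<^esub> v = \<one>\<^bsub>twisted_group_ring k G c\<^esub>"
      unfolding Units_def by blast
    have uP: "u \<in> carrier G \<rightarrow>\<^sub>E carrier k" "finite (supp k G u)"
      and vP: "v \<in> carrier G \<rightarrow>\<^sub>E carrier k" "finite (supp k G v)"
      using u v by (auto simp: twisted_group_ring_def)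
    define S where "S = (\<lambda>(\<alpha>, \<beta>). c \<alpha> \<beta>) ` (carrier G \<times> carrier G) \<union> u ` carrier G \<union> v ` carrier G"
    have S: "S \<subseteq> carrier k"
      using uP vP cC by (auto simp: S_def)
    define K where "K = generate_field k S"
    define kK where "kK = k\<lparr>carrier := K\<rparr>"
    have SK: "S \<subseteq> K" by (auto simp: K_def generate_field.incl)
    have Kk: "K \<subseteq> carrier k" unfolding K_def by (rule k.generate_field_incl[OF S])
    have sK: "subfield K k" unfolding K_def by (rule k.generate_field_is_subfield[OF S])
    interpret kK: field kK
      unfolding kK_def K_def by (rule k.generate_field_is_field[OF S])

    let ?r = "|UNIV :: ('g + nat) set|"
    have inf: "infinite (UNIV :: ('g + nat) set)" by simp
    have r: "infinite (Field ?r)" "Card_order ?r"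
      by (simp_all add: Field_card_of card_of_Card_order)
    have g: "|carrier G| \<le>o ?r"
      by (intro card_of_ordLeq[THEN iffD1] exI[of _ Inl]) auto
    have "|S| \<le>o ?r"
      unfolding S_def
      by (intro card_of_Un_ordLeq_infinite_Field r card_of_image[THEN ordLeq_transitive]
          card_of_Times_ordLeq_infinite_Field g)
    hence "|K| \<le>o ?r"
      unfolding K_def by (rule card_generate_field[OF inf])
    then obtain \<phi> :: "'k \<Rightarrow> 'g + nat" where \<phi>: "inj_on \<phi> (carrier kK)"
      using card_of_ordLeq[of K "UNIV :: ('g + nat) set"] by (auto simp: kK_def)
    define k' where "k' = image_ring \<phi> kK"
    define \<psi> where "\<psi> = inv_into (carrier kK) \<phi>"
    interpret k': field k'
      unfolding k'_def by (rule kK.inj_imp_image_ring_is_field[OF \<phi>])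
    have "\<phi> \<in> ring_iso kK k'"
      unfolding k'_def by (rule inj_imp_image_ring_iso[OF \<phi>])
    hence "\<psi> \<in> ring_iso k' kK"
      unfolding \<psi>_def by (rule ring_iso_set_sym[OF kK.ring_axioms])
    hence \<psi>K: "\<psi> \<in> ring_hom k' kK" and bij: "bij_betw \<psi> (carrier k') K"
      by (auto simp: ring_iso_def kK_def)
    have \<psi>: "\<psi> \<in> ring_hom k' k"
      using \<psi>K Kk by (auto simp: ring_hom_def kK_def)
    have inj: "inj_on \<psi> (carrier k')" using bij by (simp add: bij_betw_def)
    have \<phi>C: "\<phi> x \<in> carrier k'" if "x \<in> K" for x
      using that by (simp add: k'_def image_ring_carrier kK_def)
    have \<psi>\<phi>: "\<psi> (\<phi> x) = x" if "x \<in> K" for x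
      using that \<phi> by (simp add: \<psi>_def kK_def)
    interpret \<psi>: ring_hom_cring k' k \<psi>
      by (intro ring_hom_cring.intro ring_hom_cring_axioms.intro k'.cring_axioms k.cring_axioms \<psi>)

    define c' where "c' \<alpha> \<beta> = \<phi> (c \<alpha> \<beta>)" for \<alpha> \<beta>
    define u' where "u' = (\<lambda>x\<in>carrier G. \<phi> (u x))"
    define v' where "v' = (\<lambda>x\<in>carrier G. \<phi> (v x))"
    have cK: "c \<alpha> \<beta> \<in> K" if "\<alpha> \<in> carrier G" "\<beta> \<in> carrier G" for \<alpha> \<beta>
      using SK that by (force simp: S_def)
    have uK: "u x \<in> K" and vK: "v x \<in> K" if "x \<in> carrier G" for x
      using SK that by (auto simp: S_def)
    have c'C: "c' \<alpha> \<beta> \<in> carrier k'" if "\<alpha> \<in> carrier G" "\<beta> \<in> carrier G" for \<alpha> \<beta>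
      using cK[OF that] \<phi>C by (simp add: c'_def)
    have \<psi>c: "\<psi> (c' \<alpha> \<beta>) = c \<alpha> \<beta>" if "\<alpha> \<in> carrier G" "\<beta> \<in> carrier G" for \<alpha> \<beta>
      using cK[OF that] by (simp add: c'_def \<psi>\<phi>)
    have u'P: "u' \<in> carrier G \<rightarrow>\<^sub>E carrier k'" and v'P: "v' \<in> carrier G \<rightarrow>\<^sub>E carrier k'"
      using uK vK \<phi>C by (auto simp: u'_def v'_def)
    have \<psi>u: "(\<lambda>x\<in>carrier G. \<psi> (u' x)) = u" and \<psi>v: "(\<lambda>x\<in>carrier G. \<psi> (v' x)) = v"
      using uP vP uK vK
      by (auto simp: u'_def v'_def \<psi>\<phi> fun_eq_iff restrict_def PiE_def extensional_def)
    have \<psi>_eq: "x = y" if "\<psi> x = \<psi> y" "x \<in> carrier k'" "y \<in> carrier k'" for x y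
      using that inj by (auto dest: inj_onD)

    have c': "normalised_cocycle k' G c'"
      unfolding normalised_cocycle_def
    proof (intro conjI ballI)
      fix \<alpha> \<beta> assume ab: "\<alpha> \<in> carrier G" "\<beta> \<in> carrier G"
      have "c \<alpha> \<beta> \<noteq> \<zero>\<^bsub>k\<^esub>" using cU[OF ab] by (simp add: k.field_Units)
      hence "c' \<alpha> \<beta> \<noteq> \<zero>\<^bsub>k'\<^esub>" using \<psi>c[OF ab] \<psi>.hom_zero by metis
      thus "c' \<alpha> \<beta> \<in> Units k'" using c'C[OF ab] by (simp add: k'.field_Units)
    next
      fix \<alpha> \<beta> \<gamma> assume abc: "\<alpha> \<in> carrier G" "\<beta> \<in> carrier G" "\<gamma> \<in> carrier G"
      show "c' \<alpha> \<beta> \<otimes>\<^bsub>k'\<^esub> c' (\<alpha> \<otimes>\<^bsub>G\<^esub> \<beta>) \<gamma> = c' \<alpha> (\<beta> \<otimes>\<^bsub>G\<^esub> \<gamma>) \<otimes>\<^bsub>k'\<^esub> c' \<beta> \<gamma>"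
        using c abc by (intro \<psi>_eq) (auto simp: c'C \<psi>c normalised_cocycle_def)
    next
      fix \<gamma> assume "\<gamma> \<in> carrier G"
      thus "c' \<one>\<^bsub>G\<^esub> \<gamma> = \<one>\<^bsub>k'\<^esub>" "c' \<gamma> \<one>\<^bsub>G\<^esub> = \<one>\<^bsub>k'\<^esub>"
        using c by (auto intro!: \<psi>_eq simp: c'C \<psi>c normalised_cocycle_def)
    qed

    have transfer: "x \<otimes>\<^bsub>twisted_group_ring k' G c'\<^esub> y = \<one>\<^bsub>twisted_group_ring k' G c'\<^esub>"
      if xy: "x \<in> carrier G \<rightarrow>\<^sub>E carrier k'" "y \<in> carrier G \<rightarrow>\<^sub>E carrier k'"
        and eq: "(\<lambda>g\<in>carrier G. \<psi> (x g)) \<otimes>\<^bsub>twisted_group_ring k G c\<^esub> (\<lambda>g\<in>carrier G. \<psi> (y g))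
                 = \<one>\<^bsub>twisted_group_ring k G c\<^esub>" for x y
    proof (rule ext)
      fix \<beta>
      let ?z = "x \<otimes>\<^bsub>twisted_group_ring k' G c'\<^esub> y"
      have xy': "x \<in> carrier G \<rightarrow> carrier k'" "y \<in> carrier G \<rightarrow> carrier k'"
        using xy by auto
      have "(\<lambda>g\<in>carrier G. \<psi> (?z g)) = \<one>\<^bsub>twisted_group_ring k G c\<^esub>"
        using twisted_mult_inj_hom[OF group_axioms k'.cring_axioms k.cring_axioms \<psi> inj c'C \<psi>c[symmetric] xy'] eq
        by simp
      hence z: "\<psi> (?z g) = (if g = \<one>\<^bsub>G\<^esub> then \<one>\<^bsub>k\<^esub> else \<zero>\<^bsub>k\<^esub>)" if "g \<in> carrier G" for g
        using that by (auto simp: twisted_group_ring_def point_mass_def fun_eq_iff dest: spec[of _ g] split: if_splits)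
      show "?z \<beta> = \<one>\<^bsub>twisted_group_ring k' G c'\<^esub> \<beta>"
      proof (cases "\<beta> \<in> carrier G")
        case True
        have sub: "supp k' G x \<subseteq> carrier G" by (auto simp: supp_def)
        have "?z \<beta> \<in> carrier k'"
          using True sub xy' c'C
          by (auto simp: twisted_group_ring_def Pi_def subset_iff intro!: k'.finsum_closed)
        hence "?z \<beta> = (if \<beta> = \<one>\<^bsub>G\<^esub> then \<one>\<^bsub>k'\<^esub> else \<zero>\<^bsub>k'\<^esub>)"
          using z[OF True] by (intro \<psi>_eq) auto
        thus ?thesis using True by (simp add: twisted_group_ring_def point_mass_def)
      qed (simp add: twisted_group_ring_def point_mass_def)
    qed

    have "supp k' G u' = supp k G u" "supp k' G v' = supp k G v"
      using supp_inj_hom[OF k'.ring_axioms k.ring_axioms \<psi> inj, of u' G]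
        supp_inj_hom[OF k'.ring_axioms k.ring_axioms \<psi> inj, of v' G] u'P v'P \<psi>u \<psi>v
      by (auto simp: PiE_def)
    hence "u' \<in> carrier (twisted_group_ring k' G c')" "v' \<in> carrier (twisted_group_ring k' G c')"
      using u'P v'P uP vP by (auto simp: twisted_group_ring_def)
    moreover have "u' \<otimes>\<^bsub>twisted_group_ring k' G c'\<^esub> v' = \<one>\<^bsub>twisted_group_ring k' G c'\<^esub>"
      "v' \<otimes>\<^bsub>twisted_group_ring k' G c'\<^esub> u' = \<one>\<^bsub>twisted_group_ring k' G c'\<^esub>"
      using transfer[OF u'P v'P] transfer[OF v'P u'P] uv vu by (simp_all add: \<psi>u \<psi>v)
    ultimately have "u' \<in> Units (twisted_group_ring k' G c')"
      unfolding Units_def by blast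
    moreover have "no_nontrivial_units k' G c'"
      using G c' k'.field_axioms unfolding trivial_units_only_def by blast
    ultimately obtain t g where tg: "u' = point_mass k' G t g" "t \<in> Units k'" "g \<in> carrier G"
      unfolding no_nontrivial_units_def trivial_units_def by blast
    have t: "t \<in> carrier k'" "t \<noteq> \<zero>\<^bsub>k'\<^esub>"
      using tg(2) by (auto simp: k'.field_Units)
    have "\<psi> t \<noteq> \<zero>\<^bsub>k\<^esub>"
      using t \<psi>_eq[of t "\<zero>\<^bsub>k'\<^esub>"] by auto
    hence "\<psi> t \<in> Units k" using t by (simp add: k.field_Units)
    moreover have "u = point_mass k G (\<psi> t) g"
      unfolding \<psi>u[symmetric] tg(1) by (auto simp: point_mass_def fun_eq_iff)
    ultimately show ?thesis
      using tg(3) unfolding trivial_units_def by blast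
  qed
  thus ?thesis unfolding no_nontrivial_units_def by blast
qed

end

theory Submission
  imports Defs
begin

text \<open>
  If \<open>G\<close> contains some \<open>g \<noteq> e\<close>, then a defect of \<open>R\<close> gives a unit with two terms: an idempotent
  \<open>p\<close> gives \<open>p \<delta>\<^sub>e + (1 - p) \<delta>\<^sub>g\<close>, whose inverse is
  \<open>p \<delta>\<^sub>e + c(g, g\<^sup>-\<^sup>1)\<^sup>-\<^sup>1 (1 - p) \<delta>\<close> with \<open>\<delta>\<close> the point mass at \<open>g\<^sup>-\<^sup>1\<close>, and a \<open>y\<close> with
  \<open>y\<^sup>2 = 0\<close> gives \<open>\<delta>\<^sub>e + y \<delta>\<^sub>g\<close>, with inverse \<open>\<delta>\<^sub>e - y \<delta>\<^sub>g\<close>. These are trivial only if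
  \<open>p \<in> {0, 1}\<close> and \<open>y = 0\<close>, and the vanishing of all square-zero elements makes \<open>R\<close> reduced.

  Conversely, let \<open>R\<close> be reduced and indecomposable and let \<open>u\<close> be a unit with inverse \<open>v\<close>. A
  homomorphism from \<open>R\<close> to a field \<open>k\<close> carries \<open>c\<close> to a cocycle and \<open>u\<close> to a unit over \<open>k\<close>, which
  is trivial by hypothesis; so it kills \<open>u(g) u(h)\<close> whenever \<open>g \<noteq> h\<close>. An element killed by every
  homomorphism to a field is nilpotent (\<open>non_nilpotent_imp_field_hom\<close>), hence zero as \<open>R\<close> is
  reduced: the coefficients of \<open>u\<close> are pairwise orthogonal. The coefficient of \<open>u v = \<delta>\<^sub>e\<close> at \<open>e\<close>
  now writes \<open>1\<close> as a sum of orthogonal elements, one for each coefficient \<open>u(\<alpha>)\<close> and divisible by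
  it. They are idempotent, so (unless \<open>R = 0\<close>) one of them is \<open>1\<close>; the
  corresponding \<open>u(\<alpha>)\<close> is invertible, and orthogonality makes all other coefficients vanish.

  For a group with unique products, compare \<open>u v = \<delta>\<^sub>e\<close> over a field with the supports \<open>A\<close> of \<open>u\<close>
  and \<open>B\<close> of \<open>v\<close>: a product \<open>a b\<close> that arises only once has a nonzero coefficient, so \<open>a b = e\<close>.
  Hence at most one pair in \<open>A \<times> B\<close> has a product that arises only once. By Strojnowski's theorem
  (\<open>two_unique_products\<close>) the unique product property then forces \<open>A\<close> to be a singleton.
\<close>

section \<open>Homomorphisms to fields\<close>

lemma (in ring) ideal_subset_maximalideal:
  assumes "ideal I R" "\<one> \<notin> I"
  shows "\<exists>M. maximalideal M R \<and> I \<subseteq> M"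
proof -
  let ?P = "{J. ideal J R \<and> I \<subseteq> J \<and> \<one> \<notin> J}"
  have "\<exists>M\<in>?P. \<forall>J\<in>?P. M \<subseteq> J \<longrightarrow> J = M"
  proof (rule subset_Zorn_nonempty)
    show "?P \<noteq> {}" using assms by blast
  next
    fix C assume C: "C \<noteq> {}" "subset.chain ?P C"
    hence "subset.chain {J. ideal J R} C" by (auto simp: pred_on.chain_def)
    hence "ideal (\<Union>C) R" using chain_Union_is_ideal[of C] C(1) by simp
    thus "\<Union>C \<in> ?P" using C by (auto simp: pred_on.chain_def)
  qed
  then obtain M where MP: "M \<in> ?P" and max: "\<forall>J\<in>?P. M \<subseteq> J \<longrightarrow> J = M" ..
  have M: "ideal M R" "I \<subseteq> M" "\<one> \<notin> M" using MP by auto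
  have "maximalideal M R"
  proof (rule maximalidealI[OF M(1)])
    show "carrier R \<noteq> M" using M(3) by blast
  next
    fix J assume J: "ideal J R" "M \<subseteq> J" "J \<subseteq> carrier R"
    show "J = M \<or> J = carrier R"
    proof (cases "\<one> \<in> J")
      case True
      thus ?thesis using ideal.one_imp_carrier[OF J(1)] by simp
    next
      case False
      hence "J \<in> ?P" using J M(2) by auto
      thus ?thesis using max J(2) by simp
    qed
  qed
  thus ?thesis using M(2) by blast
qed

text \<open>
  If \<open>1 = (1 - x T) q\<close>, then \<open>q\<close> is the geometric series: comparing coefficients gives
  \<open>q\<^sub>n = x\<^sup>n\<close> for all \<open>n\<close>. Since \<open>q\<close> is a polynomial, some power of \<open>x\<close> vanishes.
\<close>

lemma (in UP_cring) non_nilpotent_imp_one_notin_ideal: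
  assumes x: "x \<in> carrier R" and nil: "\<And>n::nat. x [^] n \<noteq> \<zero>"
  shows "\<one>\<^bsub>P\<^esub> \<notin> PIdl\<^bsub>P\<^esub> (\<one>\<^bsub>P\<^esub> \<ominus>\<^bsub>P\<^esub> up_ring.monom P x 1)"
proof
  assume "\<one>\<^bsub>P\<^esub> \<in> PIdl\<^bsub>P\<^esub> (\<one>\<^bsub>P\<^esub> \<ominus>\<^bsub>P\<^esub> up_ring.monom P x 1)"
  then obtain q where q: "q \<in> carrier P" and "\<one>\<^bsub>P\<^esub> = q \<otimes>\<^bsub>P\<^esub> (\<one>\<^bsub>P\<^esub> \<ominus>\<^bsub>P\<^esub> up_ring.monom P x 1)"
    by (auto simp: cgenideal_def)
  moreover have X: "up_ring.monom P x 1 \<in> carrier P" using x by simp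
  ultimately have "\<one>\<^bsub>P\<^esub> = q \<ominus>\<^bsub>P\<^esub> up_ring.monom P x 1 \<otimes>\<^bsub>P\<^esub> q"
    by (simp add: P.r_minus P.r_distr P.minus_eq P.m_comm)
  hence "q = \<one>\<^bsub>P\<^esub> \<oplus>\<^bsub>P\<^esub> up_ring.monom P x 1 \<otimes>\<^bsub>P\<^esub> q"
    using q X by (simp add: P.minus_eq P.a_assoc P.l_neg)
  hence eq: "up_ring.coeff P q n = up_ring.coeff P \<one>\<^bsub>P\<^esub> n \<oplus> up_ring.coeff P (up_ring.monom P x 1 \<otimes>\<^bsub>P\<^esub> q) n" for n
    using q X coeff_add[of "\<one>\<^bsub>P\<^esub>" "up_ring.monom P x 1 \<otimes>\<^bsub>P\<^esub> q" n] P.m_closed[OF X q] by (metis P.one_closed)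
  have "up_ring.coeff P q n = x [^] n" for n
  proof (induction n)
    case 0
    have "up_ring.coeff P (up_ring.monom P x 1 \<otimes>\<^bsub>P\<^esub> q) 0 = \<zero>"
      using q x by (simp add: coeff_mult[OF X q])
    thus ?case using eq[of 0] by simp
  next
    case (Suc n)
    have "up_ring.coeff P (up_ring.monom P x 1 \<otimes>\<^bsub>P\<^esub> q) (Suc n) = x \<otimes> up_ring.coeff P q n"
      using coeff_monom_mult[OF x q, of 1 n] by simp
    thus ?case using eq[of "Suc n"] Suc x by (simp add: R.m_comm)
  qed
  moreover have "up_ring.coeff P q (Suc (deg R q)) = \<zero>"
    using q by (simp add: deg_aboveD)
  ultimately show False using nil by metis
qed

text \<open>
  The ring \<open>R[T] / (1 - x T)\<close> is the localisation of \<open>R\<close> at the powers of \<open>x\<close>. It is nonzero because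
  \<open>x\<close> is not nilpotent, so it has a residue field, in which the image of \<open>x\<close> is invertible, with inverse the image of \<open>T\<close>.
\<close>

lemma (in cring) non_nilpotent_imp_field_hom:
  assumes x: "x \<in> carrier R" and nil: "\<And>n::nat. x [^] n \<noteq> \<zero>"
  shows "\<exists>(k :: (nat \<Rightarrow> 'a) set ring) h. field k \<and> h \<in> ring_hom R k \<and> h x \<noteq> \<zero>\<^bsub>k\<^esub>"
proof -
  interpret UP_cring R "UP R" by (intro UP_cring.intro cring_axioms)
  let ?P = "UP R"
  let ?p = "\<one>\<^bsub>?P\<^esub> \<ominus>\<^bsub>?P\<^esub> up_ring.monom ?P x 1"
  have X: "up_ring.monom ?P x 1 \<in> carrier ?P" and p: "?p \<in> carrier ?P" using x by simp_all
  obtain M where M: "maximalideal M ?P" and sub: "PIdl\<^bsub>?P\<^esub> ?p \<subseteq> M"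
    using P.ideal_subset_maximalideal[OF P.cgenideal_ideal[OF p]]
      non_nilpotent_imp_one_notin_ideal[OF x nil] by blast
  interpret M: maximalideal M ?P by fact
  let ?k = "?P Quot M"
  interpret k: field ?k by (rule M.quotient_is_field[OF P.is_cring])
  interpret q: ring_hom_cring ?P ?k "(+>\<^bsub>?P\<^esub>) M" by (rule M.rcos_ring_hom_cring[OF P.is_cring])
  define h where "h a = M +>\<^bsub>?P\<^esub> up_ring.monom ?P a 0" for a
  have h: "h \<in> ring_hom R ?k"
    using ring_hom_trans[OF const_ring_hom M.rcos_ring_hom] by (simp add: h_def[abs_def] comp_def)
  have "?p \<in> M" using sub P.cgenideal_self[OF p] by blast
  hence "M +>\<^bsub>?P\<^esub> \<one>\<^bsub>?P\<^esub> = M +>\<^bsub>?P\<^esub> up_ring.monom ?P x 1"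
    using P.quotient_eq_iff_same_a_r_cos[OF M.is_ideal _ X] by blast
  also have "up_ring.monom ?P x 1 = up_ring.monom ?P x 0 \<otimes>\<^bsub>?P\<^esub> up_ring.monom ?P \<one> 1"
    using monom_mult[of x \<one> 0 1] x by simp
  finally have one: "\<one>\<^bsub>?k\<^esub> = h x \<otimes>\<^bsub>?k\<^esub> (M +>\<^bsub>?P\<^esub> up_ring.monom ?P \<one> 1)"
    using x by (simp add: h_def)
  have "h x \<noteq> \<zero>\<^bsub>?k\<^esub>"
  proof
    assume "h x = \<zero>\<^bsub>?k\<^esub>"
    hence "\<one>\<^bsub>?k\<^esub> = \<zero>\<^bsub>?k\<^esub>" using one q.hom_closed[of "up_ring.monom ?P \<one> 1"] by simp
    thus False by simp
  qed
  thus ?thesis using h k.field_axioms by blast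
qed

section \<open>Twisted group rings\<close>

locale twisted_group = group G + R: cring R
  for G :: "('g, 'n) monoid_scheme" (structure) and R :: "('r, 'm) ring_scheme" +
  fixes c :: "'g \<Rightarrow> 'g \<Rightarrow> 'r"
  assumes cocycle: "normalised_cocycle R G c"
begin

abbreviation "T \<equiv> twisted_group_ring R G c"

lemma c_unit: "\<alpha> \<in> carrier G \<Longrightarrow> \<beta> \<in> carrier G \<Longrightarrow> c \<alpha> \<beta> \<in> Units R"
  and c_one [simp]: "\<gamma> \<in> carrier G \<Longrightarrow> c \<one> \<gamma> = \<one>\<^bsub>R\<^esub>" "\<gamma> \<in> carrier G \<Longrightarrow> c \<gamma> \<one> = \<one>\<^bsub>R\<^esub>"
  using cocycle by (auto simp: normalised_cocycle_def)

lemma c_closed [simp, intro]: "\<alpha> \<in> carrier G \<Longrightarrow> \<beta> \<in> carrier G \<Longrightarrow> c \<alpha> \<beta> \<in> carrier R"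
  using c_unit by blast

lemma c_inv_commute:
  assumes "g \<in> carrier G"
  shows "c (inv g) g = c g (inv g)"
proof -
  have "c g (inv g) \<otimes>\<^bsub>R\<^esub> c (g \<otimes> inv g) g = c g (inv g \<otimes> g) \<otimes>\<^bsub>R\<^esub> c (inv g) g"
    using cocycle assms unfolding normalised_cocycle_def by blast
  thus ?thesis using assms by simp
qed

lemma carrier_T: "f \<in> carrier T \<longleftrightarrow> f \<in> carrier G \<rightarrow>\<^sub>E carrier R \<and> finite (supp R G f)"
  by (simp add: twisted_group_ring_def)

lemma carrier_T_closed [simp]: "f \<in> carrier T \<Longrightarrow> x \<in> carrier G \<Longrightarrow> f x \<in> carrier R"
  by (auto simp: carrier_T)

lemma finite_supp: "f \<in> carrier T \<Longrightarrow> finite (supp R G f)"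
  by (simp add: carrier_T)

lemma supp_subset: "supp R G f \<subseteq> carrier G"
  by (auto simp: supp_def)

lemma T_ext:
  assumes "f \<in> extensional (carrier G)" "h \<in> extensional (carrier G)"
    and "\<And>x. x \<in> carrier G \<Longrightarrow> f x = h x"
  shows "f = h"
  using assms by (rule extensionalityI)

lemma mult_extensional [simp]: "f \<otimes>\<^bsub>T\<^esub> h \<in> extensional (carrier G)"
  and add_extensional [simp]: "f \<oplus>\<^bsub>T\<^esub> h \<in> extensional (carrier G)"
  and point_mass_extensional [simp]: "point_mass R G a g \<in> extensional (carrier G)"
  by (simp_all add: twisted_group_ring_def point_mass_def)

lemma add_apply [simp]: "x \<in> carrier G \<Longrightarrow> (f \<oplus>\<^bsub>T\<^esub> h) x = f x \<oplus>\<^bsub>R\<^esub> h x"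
  and one_T: "\<one>\<^bsub>T\<^esub> = point_mass R G \<one>\<^bsub>R\<^esub> \<one>"
  and point_mass_apply [simp]:
    "x \<in> carrier G \<Longrightarrow> point_mass R G a g x = (if x = g then a else \<zero>\<^bsub>R\<^esub>)"
  by (simp_all add: twisted_group_ring_def point_mass_def)

text \<open>
  The product is defined as a sum over the support of the left factor. Sums of functions and ring
  homomorphisms change this support, so a larger finite index set is needed to compare products.
\<close>

lemma mult_apply:
  assumes f: "f \<in> carrier T" and h: "h \<in> carrier T" and \<beta>: "\<beta> \<in> carrier G"
    and A: "finite A" "supp R G f \<subseteq> A" "A \<subseteq> carrier G"
  shows "(f \<otimes>\<^bsub>T\<^esub> h) \<beta> =
    (\<Oplus>\<^bsub>R\<^esub>\<alpha>\<in>A. c \<alpha> (inv \<alpha> \<otimes> \<beta>) \<otimes>\<^bsub>R\<^esub> f \<alpha> \<otimes>\<^bsub>R\<^esub> h (inv \<alpha> \<otimes> \<beta>))"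
proof -
  have "(\<Oplus>\<^bsub>R\<^esub>\<alpha>\<in>supp R G f. c \<alpha> (inv \<alpha> \<otimes> \<beta>) \<otimes>\<^bsub>R\<^esub> f \<alpha> \<otimes>\<^bsub>R\<^esub> h (inv \<alpha> \<otimes> \<beta>)) =
    (\<Oplus>\<^bsub>R\<^esub>\<alpha>\<in>A. c \<alpha> (inv \<alpha> \<otimes> \<beta>) \<otimes>\<^bsub>R\<^esub> f \<alpha> \<otimes>\<^bsub>R\<^esub> h (inv \<alpha> \<otimes> \<beta>))"
  proof (rule R.add.finprod_mono_neutral_cong_left[OF A(1,2)])
    fix i assume "i \<in> A - supp R G f"
    thus "c i (inv i \<otimes> \<beta>) \<otimes>\<^bsub>R\<^esub> f i \<otimes>\<^bsub>R\<^esub> h (inv i \<otimes> \<beta>) = \<zero>\<^bsub>R\<^esub>"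
      using A(3) f h \<beta> by (auto simp: supp_def)
  next
    show "(\<lambda>\<alpha>. c \<alpha> (inv \<alpha> \<otimes> \<beta>) \<otimes>\<^bsub>R\<^esub> f \<alpha> \<otimes>\<^bsub>R\<^esub> h (inv \<alpha> \<otimes> \<beta>)) \<in> A \<rightarrow> carrier R"
      using A(3) f h \<beta> by auto
  qed simp
  thus ?thesis using \<beta> by (simp add: twisted_group_ring_def)
qed

lemma point_mass_closed [simp]:
  assumes "a \<in> carrier R"
  shows "point_mass R G a g \<in> carrier T"
proof -
  have "supp R G (point_mass R G a g) \<subseteq> {g}"
    by (auto simp: supp_def split: if_splits)
  thus ?thesis
    using assms finite_subset by (fastforce simp: carrier_T point_mass_def)
qed

lemma add_closed [simp]:
  assumes "f \<in> carrier T" "h \<in> carrier T"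
  shows "f \<oplus>\<^bsub>T\<^esub> h \<in> carrier T"
proof -
  have "supp R G (f \<oplus>\<^bsub>T\<^esub> h) \<subseteq> supp R G f \<union> supp R G h"
    by (auto simp: supp_def)
  moreover have "finite (supp R G f \<union> supp R G h)"
    using assms by (simp add: carrier_T)
  moreover have "f \<oplus>\<^bsub>T\<^esub> h \<in> carrier G \<rightarrow>\<^sub>E carrier R"
    using assms by (auto simp: PiE_def)
  ultimately show ?thesis
    using finite_subset by (auto simp: carrier_T)
qed

lemma distrib_right:
  assumes f: "f \<in> carrier T" and g: "g \<in> carrier T" and h: "h \<in> carrier T"
  shows "(f \<oplus>\<^bsub>T\<^esub> g) \<otimes>\<^bsub>T\<^esub> h = f \<otimes>\<^bsub>T\<^esub> h \<oplus>\<^bsub>T\<^esub> g \<otimes>\<^bsub>T\<^esub> h"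
proof (rule T_ext)
  fix \<beta> assume \<beta>: "\<beta> \<in> carrier G"
  let ?A = "supp R G f \<union> supp R G g"
  have A: "finite ?A" "?A \<subseteq> carrier G" "supp R G (f \<oplus>\<^bsub>T\<^esub> g) \<subseteq> ?A"
    using finite_supp[OF f] finite_supp[OF g] supp_subset by (simp, simp, auto simp: supp_def)
  hence AG: "\<alpha> \<in> carrier G" if "\<alpha> \<in> ?A" for \<alpha> using that by blast
  have "(\<Oplus>\<^bsub>R\<^esub>\<alpha>\<in>?A. c \<alpha> (inv \<alpha> \<otimes> \<beta>) \<otimes>\<^bsub>R\<^esub> (f \<oplus>\<^bsub>T\<^esub> g) \<alpha> \<otimes>\<^bsub>R\<^esub> h (inv \<alpha> \<otimes> \<beta>)) =
    (\<Oplus>\<^bsub>R\<^esub>\<alpha>\<in>?A. c \<alpha> (inv \<alpha> \<otimes> \<beta>) \<otimes>\<^bsub>R\<^esub> f \<alpha> \<otimes>\<^bsub>R\<^esub> h (inv \<alpha> \<otimes> \<beta>)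
              \<oplus>\<^bsub>R\<^esub> c \<alpha> (inv \<alpha> \<otimes> \<beta>) \<otimes>\<^bsub>R\<^esub> g \<alpha> \<otimes>\<^bsub>R\<^esub> h (inv \<alpha> \<otimes> \<beta>))"
    (is "(\<Oplus>\<^bsub>R\<^esub>\<alpha>\<in>_. ?L \<alpha>) = (\<Oplus>\<^bsub>R\<^esub>\<alpha>\<in>_. ?R \<alpha>)")
  proof (rule R.finsum_cong'[OF refl])
    fix \<alpha> assume "\<alpha> \<in> ?A"
    hence "\<alpha> \<in> carrier G" "inv \<alpha> \<otimes> \<beta> \<in> carrier G" using AG \<beta> by auto
    thus "?L \<alpha> = ?R \<alpha>"
      using f g h by (simp add: R.l_distr R.r_distr)
  qed (use f g h \<beta> AG in auto)
  thus "((f \<oplus>\<^bsub>T\<^esub> g) \<otimes>\<^bsub>T\<^esub> h) \<beta> = (f \<otimes>\<^bsub>T\<^esub> h \<oplus>\<^bsub>T\<^esub> g \<otimes>\<^bsub>T\<^esub> h) \<beta>"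
    using f g h \<beta> A AG
    by (simp add: mult_apply[where A = ?A] R.finsum_addf Pi_def)
qed simp_all

lemma distrib_left:
  assumes f: "f \<in> carrier T" and g: "g \<in> carrier T" and h: "h \<in> carrier T"
  shows "f \<otimes>\<^bsub>T\<^esub> (g \<oplus>\<^bsub>T\<^esub> h) = f \<otimes>\<^bsub>T\<^esub> g \<oplus>\<^bsub>T\<^esub> f \<otimes>\<^bsub>T\<^esub> h"
proof (rule T_ext)
  fix \<beta> assume \<beta>: "\<beta> \<in> carrier G"
  let ?A = "supp R G f"
  have A: "finite ?A" "?A \<subseteq> carrier G"
    using finite_supp[OF f] supp_subset by simp_all
  hence AG: "\<alpha> \<in> carrier G" if "\<alpha> \<in> ?A" for \<alpha> using that by blast
  have "(\<Oplus>\<^bsub>R\<^esub>\<alpha>\<in>?A. c \<alpha> (inv \<alpha> \<otimes> \<beta>) \<otimes>\<^bsub>R\<^esub> f \<alpha> \<otimes>\<^bsub>R\<^esub> (g \<oplus>\<^bsub>T\<^esub> h) (inv \<alpha> \<otimes> \<beta>)) =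
    (\<Oplus>\<^bsub>R\<^esub>\<alpha>\<in>?A. c \<alpha> (inv \<alpha> \<otimes> \<beta>) \<otimes>\<^bsub>R\<^esub> f \<alpha> \<otimes>\<^bsub>R\<^esub> g (inv \<alpha> \<otimes> \<beta>)
              \<oplus>\<^bsub>R\<^esub> c \<alpha> (inv \<alpha> \<otimes> \<beta>) \<otimes>\<^bsub>R\<^esub> f \<alpha> \<otimes>\<^bsub>R\<^esub> h (inv \<alpha> \<otimes> \<beta>))"
    (is "(\<Oplus>\<^bsub>R\<^esub>\<alpha>\<in>_. ?L \<alpha>) = (\<Oplus>\<^bsub>R\<^esub>\<alpha>\<in>_. ?R \<alpha>)")
  proof (rule R.finsum_cong'[OF refl])
    fix \<alpha> assume "\<alpha> \<in> ?A"
    hence "\<alpha> \<in> carrier G" "inv \<alpha> \<otimes> \<beta> \<in> carrier G" using AG \<beta> by auto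
    thus "?L \<alpha> = ?R \<alpha>"
      using f g h by (simp add: R.l_distr R.r_distr)
  qed (use f g h \<beta> AG in auto)
  thus "(f \<otimes>\<^bsub>T\<^esub> (g \<oplus>\<^bsub>T\<^esub> h)) \<beta> = (f \<otimes>\<^bsub>T\<^esub> g \<oplus>\<^bsub>T\<^esub> f \<otimes>\<^bsub>T\<^esub> h) \<beta>"
    using f g h \<beta> A AG
    by (simp add: mult_apply[where A = ?A] R.finsum_addf Pi_def)
qed simp_all

lemma point_mass_mult:
  assumes a: "a \<in> carrier R" and b: "b \<in> carrier R" and g: "g \<in> carrier G" and h: "h \<in> carrier G"
  shows "point_mass R G a g \<otimes>\<^bsub>T\<^esub> point_mass R G b h
       = point_mass R G (c g h \<otimes>\<^bsub>R\<^esub> a \<otimes>\<^bsub>R\<^esub> b) (g \<otimes> h)"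
proof (rule T_ext)
  fix \<beta> assume \<beta>: "\<beta> \<in> carrier G"
  have "supp R G (point_mass R G a g) \<subseteq> {g}"
    by (auto simp: supp_def split: if_splits)
  hence "(point_mass R G a g \<otimes>\<^bsub>T\<^esub> point_mass R G b h) \<beta> =
      c g (inv g \<otimes> \<beta>) \<otimes>\<^bsub>R\<^esub> a \<otimes>\<^bsub>R\<^esub> (if inv g \<otimes> \<beta> = h then b else \<zero>\<^bsub>R\<^esub>)"
    using a b g \<beta> by (simp add: mult_apply[where A = "{g}"])
  moreover have "inv g \<otimes> \<beta> = h \<longleftrightarrow> \<beta> = g \<otimes> h"
    using g h \<beta> by (metis inv_closed inv_solve_left)
  ultimately show "(point_mass R G a g \<otimes>\<^bsub>T\<^esub> point_mass R G b h) \<beta> =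
      point_mass R G (c g h \<otimes>\<^bsub>R\<^esub> a \<otimes>\<^bsub>R\<^esub> b) (g \<otimes> h) \<beta>"
    using a b g h \<beta> by auto
qed simp_all

lemma Units_T_iff:
  "u \<in> Units T \<longleftrightarrow> u \<in> carrier T \<and> (\<exists>v\<in>carrier T. v \<otimes>\<^bsub>T\<^esub> u = \<one>\<^bsub>T\<^esub> \<and> u \<otimes>\<^bsub>T\<^esub> v = \<one>\<^bsub>T\<^esub>)"
  unfolding Units_def by blast

lemma two_term_mult:
  assumes "a \<in> carrier R" "b \<in> carrier R" "a' \<in> carrier R" "b' \<in> carrier R"
    and g: "g \<in> carrier G" "h \<in> carrier G"
  shows "(point_mass R G a \<one> \<oplus>\<^bsub>T\<^esub> point_mass R G b g) \<otimes>\<^bsub>T\<^esub>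
      (point_mass R G a' \<one> \<oplus>\<^bsub>T\<^esub> point_mass R G b' h) =
    (point_mass R G (a \<otimes>\<^bsub>R\<^esub> a') \<one> \<oplus>\<^bsub>T\<^esub> point_mass R G (b \<otimes>\<^bsub>R\<^esub> a') g) \<oplus>\<^bsub>T\<^esub>
    (point_mass R G (a \<otimes>\<^bsub>R\<^esub> b') h \<oplus>\<^bsub>T\<^esub> point_mass R G (c g h \<otimes>\<^bsub>R\<^esub> b \<otimes>\<^bsub>R\<^esub> b') (g \<otimes> h))"
  using assms by (simp add: distrib_right distrib_left point_mass_mult)

text \<open>
  A trivial unit is supported on a single group element, so it cannot be nonzero at both \<open>\<one>\<close> and \<open>g\<close>.
\<close>

lemma two_term_unit_imp_zero:
  assumes "no_nontrivial_units R G c" "a \<in> carrier R" "b \<in> carrier R"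
    and g: "g \<in> carrier G" "g \<noteq> \<one>"
    and "point_mass R G a \<one> \<oplus>\<^bsub>T\<^esub> point_mass R G b g \<in> Units T" (is "?u \<in> _")
  shows "a = \<zero>\<^bsub>R\<^esub> \<or> b = \<zero>\<^bsub>R\<^esub>"
proof -
  obtain t h where u: "?u = point_mass R G t h" and "h \<in> carrier G"
    using assms unfolding no_nontrivial_units_def trivial_units_def by blast
  have "?u \<one> = a" "?u g = b" using assms by simp_all
  thus ?thesis unfolding u using g by (auto split: if_splits)
qed

lemma no_nontrivial_units_imp_indecomposable:
  assumes G: "carrier G \<noteq> {\<one>}" and nt: "no_nontrivial_units R G c"
  shows "indecomposable_ring R"
  unfolding indecomposable_ring_def
proof (intro ballI impI)
  fix p assume p: "p \<in> carrier R" and pp: "p \<otimes>\<^bsub>R\<^esub> p = p"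
  obtain g where g: "g \<in> carrier G" "g \<noteq> \<one>" using G one_closed by blast
  define q where "q = \<one>\<^bsub>R\<^esub> \<ominus>\<^bsub>R\<^esub> p"
  have q: "q \<in> carrier R" using p by (simp add: q_def)
  have pq: "p \<otimes>\<^bsub>R\<^esub> q = \<zero>\<^bsub>R\<^esub>" "q \<otimes>\<^bsub>R\<^esub> p = \<zero>\<^bsub>R\<^esub>"
    using p pp by (simp_all add: q_def R.minus_eq R.r_distr R.l_distr R.r_minus R.l_minus R.r_neg)
  have sum: "p \<oplus>\<^bsub>R\<^esub> q = \<one>\<^bsub>R\<^esub>"
    using p by (simp add: q_def R.minus_eq R.a_lcomm[of p "\<one>\<^bsub>R\<^esub>"] R.r_neg)
  have qq: "q \<otimes>\<^bsub>R\<^esub> q = q"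
  proof -
    have "q = (p \<oplus>\<^bsub>R\<^esub> q) \<otimes>\<^bsub>R\<^esub> q" using sum q by simp
    thus ?thesis using p q pq by (simp add: R.l_distr)
  qed
  define d where "d = inv\<^bsub>R\<^esub> (c g (inv g))"
  have d: "d \<in> carrier R" "c g (inv g) \<otimes>\<^bsub>R\<^esub> d = \<one>\<^bsub>R\<^esub>"
    using c_unit[of g "inv g"] g by (simp_all add: d_def)
  have unit: "c g (inv g) \<otimes>\<^bsub>R\<^esub> q \<otimes>\<^bsub>R\<^esub> (d \<otimes>\<^bsub>R\<^esub> q) = q" "c g (inv g) \<otimes>\<^bsub>R\<^esub> (d \<otimes>\<^bsub>R\<^esub> q) \<otimes>\<^bsub>R\<^esub> q = q"
  proof -
    have "c g (inv g) \<otimes>\<^bsub>R\<^esub> q \<otimes>\<^bsub>R\<^esub> (d \<otimes>\<^bsub>R\<^esub> q) = (c g (inv g) \<otimes>\<^bsub>R\<^esub> d) \<otimes>\<^bsub>R\<^esub> (q \<otimes>\<^bsub>R\<^esub> q)"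
      "c g (inv g) \<otimes>\<^bsub>R\<^esub> (d \<otimes>\<^bsub>R\<^esub> q) \<otimes>\<^bsub>R\<^esub> q = (c g (inv g) \<otimes>\<^bsub>R\<^esub> d) \<otimes>\<^bsub>R\<^esub> (q \<otimes>\<^bsub>R\<^esub> q)"
      using g d(1) q by (simp_all add: R.m_ac)
    thus "c g (inv g) \<otimes>\<^bsub>R\<^esub> q \<otimes>\<^bsub>R\<^esub> (d \<otimes>\<^bsub>R\<^esub> q) = q" "c g (inv g) \<otimes>\<^bsub>R\<^esub> (d \<otimes>\<^bsub>R\<^esub> q) \<otimes>\<^bsub>R\<^esub> q = q"
      using d(2) q qq by simp_all
  qed
  have cross: "p \<otimes>\<^bsub>R\<^esub> (d \<otimes>\<^bsub>R\<^esub> q) = \<zero>\<^bsub>R\<^esub>" "(d \<otimes>\<^bsub>R\<^esub> q) \<otimes>\<^bsub>R\<^esub> p = \<zero>\<^bsub>R\<^esub>"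
    using p q d pq by (simp_all add: R.m_lcomm[of p d q] R.m_assoc)
  \<comment> \<open>The products below collapse because \<open>p\<close> and \<open>q\<close> are orthogonal idempotents with sum \<open>\<one>\<close>.\<close>
  let ?u = "point_mass R G p \<one> \<oplus>\<^bsub>T\<^esub> point_mass R G q g"
  let ?v = "point_mass R G p \<one> \<oplus>\<^bsub>T\<^esub> point_mass R G (d \<otimes>\<^bsub>R\<^esub> q) (inv g)"
  have "?u \<otimes>\<^bsub>T\<^esub> ?v = \<one>\<^bsub>T\<^esub>" "?v \<otimes>\<^bsub>T\<^esub> ?u = \<one>\<^bsub>T\<^esub>"
    using p q d g pp pq sum
    by (auto simp: one_T two_term_mult unit cross c_inv_commute intro!: T_ext)
  hence "?u \<in> Units T"
    using p q d unfolding Units_T_iff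
    by (metis R.m_closed add_closed point_mass_closed)
  hence "p = \<zero>\<^bsub>R\<^esub> \<or> q = \<zero>\<^bsub>R\<^esub>"
    by (rule two_term_unit_imp_zero[OF nt p q g])
  thus "p = \<zero>\<^bsub>R\<^esub> \<or> p = \<one>\<^bsub>R\<^esub>" using sum p by auto
qed

lemma no_nontrivial_units_imp_square_zero:
  assumes G: "carrier G \<noteq> {\<one>}" and nt: "no_nontrivial_units R G c"
    and y: "y \<in> carrier R" "y \<otimes>\<^bsub>R\<^esub> y = \<zero>\<^bsub>R\<^esub>"
  shows "y = \<zero>\<^bsub>R\<^esub>"
proof -
  obtain g where g: "g \<in> carrier G" "g \<noteq> \<one>" using G one_closed by blast
  let ?u = "point_mass R G \<one>\<^bsub>R\<^esub> \<one> \<oplus>\<^bsub>T\<^esub> point_mass R G y g"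
  let ?v = "point_mass R G \<one>\<^bsub>R\<^esub> \<one> \<oplus>\<^bsub>T\<^esub> point_mass R G (\<ominus>\<^bsub>R\<^esub> y) g"
  have "?u \<otimes>\<^bsub>T\<^esub> ?v = \<one>\<^bsub>T\<^esub>" "?v \<otimes>\<^bsub>T\<^esub> ?u = \<one>\<^bsub>T\<^esub>"
    using y g
    by (auto simp: one_T two_term_mult R.m_assoc R.r_minus R.l_minus R.r_neg R.l_neg intro!: T_ext)
  hence "?u \<in> Units T"
    using y unfolding Units_T_iff by (metis R.a_inv_closed R.one_closed add_closed point_mass_closed)
  hence "\<one>\<^bsub>R\<^esub> = \<zero>\<^bsub>R\<^esub> \<or> y = \<zero>\<^bsub>R\<^esub>"
    by (rule two_term_unit_imp_zero[OF nt R.one_closed y(1) g])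
  thus ?thesis using y(1) R.r_one R.r_null by metis
qed

lemma no_nontrivial_units_imp_reduced:
  assumes G: "carrier G \<noteq> {\<one>}" and nt: "no_nontrivial_units R G c"
  shows "reduced_ring R"
  unfolding reduced_ring_def
proof (intro ballI impI)
  fix x assume x: "x \<in> carrier R" and "\<exists>n::nat. x [^]\<^bsub>R\<^esub> n = \<zero>\<^bsub>R\<^esub>"
  then obtain n :: nat where "x [^]\<^bsub>R\<^esub> n = \<zero>\<^bsub>R\<^esub>" by blast
  thus "x = \<zero>\<^bsub>R\<^esub>"
    \<comment> \<open>For \<open>n \<ge> 1\<close>, if \<open>x\<^sup>n\<^sup>+\<^sup>1 = \<zero>\<close> then \<open>x\<^sup>n\<close> squares to \<open>\<zero>\<close>, because \<open>2n \<ge> n + 1\<close>.\<close>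
  proof (induction n)
    case 0
    thus ?case using x R.r_one R.r_null by (metis R.nat_pow_0)
  next
    case (Suc n)
    show ?case
    proof (cases "n = 0")
      case False
      then obtain m where m: "n = Suc m" by (cases n) auto
      have "x [^]\<^bsub>R\<^esub> n \<otimes>\<^bsub>R\<^esub> x [^]\<^bsub>R\<^esub> n = x [^]\<^bsub>R\<^esub> (Suc n + m)"
        using x m by (simp only: R.nat_pow_mult) simp
      also have "\<dots> = x [^]\<^bsub>R\<^esub> (Suc n) \<otimes>\<^bsub>R\<^esub> x [^]\<^bsub>R\<^esub> m"
        using x by (simp only: R.nat_pow_mult)
      also have "\<dots> = \<zero>\<^bsub>R\<^esub>"
        using x Suc.prems by (simp del: R.nat_pow_Suc)
      finally have "x [^]\<^bsub>R\<^esub> n = \<zero>\<^bsub>R\<^esub>"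
        by (rule no_nontrivial_units_imp_square_zero[OF G nt R.nat_pow_closed[OF x]])
      thus ?thesis by (rule Suc.IH)
    next
      case True
      thus ?thesis using Suc.prems x by simp
    qed
  qed
qed

end

section \<open>Change of coefficients\<close>

lemma (in ring_hom_cring) hom_Units:
  assumes "x \<in> Units R"
  shows "h x \<in> Units S"
proof -
  have "h (inv x) \<in> carrier S" "h (inv x) \<otimes>\<^bsub>S\<^esub> h x = \<one>\<^bsub>S\<^esub>" "h x \<otimes>\<^bsub>S\<^esub> h (inv x) = \<one>\<^bsub>S\<^esub>"
    using assms by (simp_all add: R.Units_closed hom_mult[symmetric] del: hom_mult)
  thus ?thesis using assms unfolding Units_def by blast
qed

locale twisted_group_hom = twisted_group G R c + S: cring S
  for G :: "('g, 'n) monoid_scheme" (structure) and R :: "('r, 'm) ring_scheme" and c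
    and S :: "('s, 'k) ring_scheme" +
  fixes h :: "'r \<Rightarrow> 's"
  assumes hom: "h \<in> ring_hom R S"
begin

sublocale h: ring_hom_cring R S h
  by (intro ring_hom_cring.intro ring_hom_cring_axioms.intro R.cring_axioms S.cring_axioms hom)

sublocale S: twisted_group G S "\<lambda>\<alpha> \<beta>. h (c \<alpha> \<beta>)"
proof unfold_locales
  show "normalised_cocycle S G (\<lambda>\<alpha> \<beta>. h (c \<alpha> \<beta>))"
    using cocycle unfolding normalised_cocycle_def
    by (auto simp: h.hom_Units h.hom_mult[symmetric] simp del: h.hom_mult)
qed

lemma image_closed:
  assumes u: "u \<in> carrier T"
  shows "(\<lambda>x\<in>carrier G. h (u x)) \<in> carrier S.T"
    and "supp S G (\<lambda>x\<in>carrier G. h (u x)) \<subseteq> supp R G u"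
proof -
  show *: "supp S G (\<lambda>x\<in>carrier G. h (u x)) \<subseteq> supp R G u"
    using h.hom_zero by (auto simp: supp_def)
  show "(\<lambda>x\<in>carrier G. h (u x)) \<in> carrier S.T"
    using u finite_subset[OF *] by (auto simp: S.carrier_T carrier_T)
qed

lemma image_mult:
  assumes u: "u \<in> carrier T" and v: "v \<in> carrier T"
  shows "(\<lambda>x\<in>carrier G. h (u x)) \<otimes>\<^bsub>S.T\<^esub> (\<lambda>x\<in>carrier G. h (v x))
       = (\<lambda>x\<in>carrier G. h ((u \<otimes>\<^bsub>T\<^esub> v) x))"
proof (rule S.T_ext)
  fix \<beta> assume \<beta>: "\<beta> \<in> carrier G"
  let ?A = "supp R G u"
  have A: "finite ?A" "?A \<subseteq> carrier G"
    using finite_supp[OF u] supp_subset by simp_all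
  hence AG: "\<alpha> \<in> carrier G" if "\<alpha> \<in> ?A" for \<alpha> using that by blast
  let ?F = "\<lambda>\<alpha>. c \<alpha> (inv \<alpha> \<otimes> \<beta>) \<otimes>\<^bsub>R\<^esub> u \<alpha> \<otimes>\<^bsub>R\<^esub> v (inv \<alpha> \<otimes> \<beta>)"
  have F: "?F \<in> ?A \<rightarrow> carrier R" using u v AG \<beta> by auto
  have "h ((u \<otimes>\<^bsub>T\<^esub> v) \<beta>) = (\<Oplus>\<^bsub>S\<^esub>\<alpha>\<in>?A. (h \<circ> ?F) \<alpha>)"
    using h.hom_finsum[OF F] u v \<beta> A by (simp add: mult_apply[where A = ?A] comp_def)
  also have "\<dots> = (\<Oplus>\<^bsub>S\<^esub>\<alpha>\<in>?A. h (c \<alpha> (inv \<alpha> \<otimes> \<beta>)) \<otimes>\<^bsub>S\<^esub> (\<lambda>x\<in>carrier G. h (u x)) \<alpha>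
      \<otimes>\<^bsub>S\<^esub> (\<lambda>x\<in>carrier G. h (v x)) (inv \<alpha> \<otimes> \<beta>))"
    using u v AG \<beta> by (intro S.finsum_cong') auto
  also have "\<dots> = ((\<lambda>x\<in>carrier G. h (u x)) \<otimes>\<^bsub>S.T\<^esub> (\<lambda>x\<in>carrier G. h (v x))) \<beta>"
    using S.mult_apply[OF image_closed(1)[OF u] image_closed(1)[OF v] \<beta> A(1) image_closed(2)[OF u] A(2)]
    by simp
  finally show "((\<lambda>x\<in>carrier G. h (u x)) \<otimes>\<^bsub>S.T\<^esub> (\<lambda>x\<in>carrier G. h (v x))) \<beta>
       = (\<lambda>x\<in>carrier G. h ((u \<otimes>\<^bsub>T\<^esub> v) x)) \<beta>"
    using \<beta> by simp
qed simp_all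

lemma image_unit:
  assumes "u \<in> Units T"
  shows "(\<lambda>x\<in>carrier G. h (u x)) \<in> Units S.T"
proof -
  obtain v where u: "u \<in> carrier T" and v: "v \<in> carrier T"
    and eq: "v \<otimes>\<^bsub>T\<^esub> u = \<one>\<^bsub>T\<^esub>" "u \<otimes>\<^bsub>T\<^esub> v = \<one>\<^bsub>T\<^esub>"
    using assms by (auto simp: Units_T_iff)
  have "(\<lambda>x\<in>carrier G. h (\<one>\<^bsub>T\<^esub> x)) = \<one>\<^bsub>S.T\<^esub>"
    by (rule S.T_ext) (auto simp: one_T S.one_T)
  thus ?thesis
    unfolding S.Units_T_iff
    using image_closed(1)[OF u] image_closed(1)[OF v] image_mult[OF u v] image_mult[OF v u] eq by auto
qed

end

section \<open>Units over reduced indecomposable rings\<close>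

text \<open>
  Over every field that \<open>R\<close> maps to, the image of \<open>u\<close> is a trivial unit, so the image of at
  least one of two coefficients at distinct group elements is zero. As \<open>R\<close> is reduced,
  homomorphisms to fields detect that the product of the two coefficients itself is zero.
\<close>

lemma (in twisted_group) unit_coeffs_orthogonal:
  assumes G: "trivial_units_only G" and red: "reduced_ring R"
    and u: "u \<in> Units T" and g: "g \<in> carrier G" "g' \<in> carrier G" "g \<noteq> g'"
  shows "u g \<otimes>\<^bsub>R\<^esub> u g' = \<zero>\<^bsub>R\<^esub>"
proof (rule ccontr)
  assume nz: "u g \<otimes>\<^bsub>R\<^esub> u g' \<noteq> \<zero>\<^bsub>R\<^esub>"
  have uC: "u \<in> carrier T" using u by (simp add: Units_T_iff)
  have C: "u g \<in> carrier R" "u g' \<in> carrier R" using uC g by simp_all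
  hence "u g \<otimes>\<^bsub>R\<^esub> u g' \<in> carrier R" by simp
  moreover from this have "(u g \<otimes>\<^bsub>R\<^esub> u g') [^]\<^bsub>R\<^esub> n \<noteq> \<zero>\<^bsub>R\<^esub>" for n :: nat
    using nz red unfolding reduced_ring_def by blast
  ultimately have "\<exists>(k :: (nat \<Rightarrow> 'r) set ring) h.
      field k \<and> h \<in> ring_hom R k \<and> h (u g \<otimes>\<^bsub>R\<^esub> u g') \<noteq> \<zero>\<^bsub>k\<^esub>"
    by (rule R.non_nilpotent_imp_field_hom)
  then obtain k :: "(nat \<Rightarrow> 'r) set ring" and h where k: "field k" and h: "h \<in> ring_hom R k"
    and hnz: "h (u g \<otimes>\<^bsub>R\<^esub> u g') \<noteq> \<zero>\<^bsub>k\<^esub>"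
    by blast
  interpret k: field k by fact
  interpret H: twisted_group_hom G R c k h
    by unfold_locales fact
  have "no_nontrivial_units k G (\<lambda>\<alpha> \<beta>. h (c \<alpha> \<beta>))"
    by (rule trivial_units_only_imp_no_nontrivial_units[OF G k H.S.cocycle])
  hence "(\<lambda>x\<in>carrier G. h (u x)) \<in> trivial_units k G"
    using H.image_unit[OF u] unfolding no_nontrivial_units_def by blast
  then obtain t a where "(\<lambda>x\<in>carrier G. h (u x)) = point_mass k G t a"
    unfolding trivial_units_def by blast
  from fun_cong[OF this, of g] fun_cong[OF this, of g']
  have "h (u g) = \<zero>\<^bsub>k\<^esub> \<or> h (u g') = \<zero>\<^bsub>k\<^esub>"
    using g by (auto split: if_splits)
  moreover have "h (u g \<otimes>\<^bsub>R\<^esub> u g') = h (u g) \<otimes>\<^bsub>k\<^esub> h (u g')"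
    by (rule H.h.hom_mult[OF C])
  ultimately show False
    using hnz H.h.hom_closed[OF C(1)] H.h.hom_closed[OF C(2)] by (metis k.l_null k.r_null)
qed

text \<open>
  Multiplying the sum by one of its terms shows that this term is idempotent, hence \<open>\<zero>\<close> or \<open>\<one>\<close>; the
  terms cannot all be \<open>\<zero>\<close>.
\<close>

lemma (in cring) orthogonal_sum_one_indecomposable:
  assumes ind: "indecomposable_ring R" and A: "finite A" "f \<in> A \<rightarrow> carrier R"
    and sum: "(\<Oplus>i\<in>A. f i) = \<one>" and nz: "\<one> \<noteq> \<zero>"
    and orth: "\<And>i j. i \<in> A \<Longrightarrow> j \<in> A \<Longrightarrow> i \<noteq> j \<Longrightarrow> f i \<otimes> f j = \<zero>"
  shows "\<exists>i\<in>A. f i = \<one>"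
proof (rule ccontr)
  assume none: "\<not> (\<exists>i\<in>A. f i = \<one>)"
  have "f i = \<zero>" if i: "i \<in> A" for i
  proof -
    have fi: "f i \<in> carrier R" using i A by auto
    have "f i = f i \<otimes> (\<Oplus>j\<in>A. f j)" using sum fi by simp
    also have "\<dots> = (\<Oplus>j\<in>A. f i \<otimes> f j)" using A fi by (simp add: finsum_rdistr)
    also have "\<dots> = (\<Oplus>j\<in>A. if i = j then f i \<otimes> f i else \<zero>)"
      using i orth fi by (intro finsum_cong') auto
    also have "\<dots> = f i \<otimes> f i"
      using finsum_singleton[OF i A(1), of "\<lambda>_. f i \<otimes> f i"] fi by simp
    finally show ?thesis
      using ind fi none i unfolding indecomposable_ring_def by metis
  qed
  hence "(\<Oplus>i\<in>A. f i) = \<zero>" by (rule add.finprod_one_eqI)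
  thus False using sum nz by simp
qed

lemma (in twisted_group) trivial_unit_if_unit_coeff_annihilates_rest:
  assumes u: "u \<in> carrier T" and g: "g \<in> carrier G" and ug: "u g \<in> Units R"
    and orth: "\<And>x. x \<in> carrier G \<Longrightarrow> x \<noteq> g \<Longrightarrow> u g \<otimes>\<^bsub>R\<^esub> u x = \<zero>\<^bsub>R\<^esub>"
  shows "u \<in> trivial_units R G"
proof -
  have "u x = \<zero>\<^bsub>R\<^esub>" if x: "x \<in> carrier G" "x \<noteq> g" for x
  proof -
    have "u g \<otimes>\<^bsub>R\<^esub> u x = u g \<otimes>\<^bsub>R\<^esub> \<zero>\<^bsub>R\<^esub>"
      using orth[OF x] R.Units_closed[OF ug] by simp
    thus ?thesis
      using R.Units_l_cancel[OF ug carrier_T_closed[OF u x(1)] R.zero_closed] by blast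
  qed
  hence "u = point_mass R G (u g) g"
    using u by (intro T_ext) (auto simp: carrier_T PiE_def)
  thus ?thesis using g ug unfolding trivial_units_def by blast
qed

lemma (in twisted_group) reduced_indecomposable_imp_no_nontrivial_units:
  assumes G: "trivial_units_only G" and red: "reduced_ring R" and ind: "indecomposable_ring R"
  shows "no_nontrivial_units R G c"
  unfolding no_nontrivial_units_def
proof
  fix u assume u: "u \<in> Units T"
  then obtain v where uC: "u \<in> carrier T" and v: "v \<in> carrier T" and uv: "u \<otimes>\<^bsub>T\<^esub> v = \<one>\<^bsub>T\<^esub>"
    by (auto simp: Units_T_iff)
  note orth = unit_coeffs_orthogonal[OF G red u]
  show "u \<in> trivial_units R G"
    \<comment> \<open>In the zero ring, \<open>\<zero>\<close> is a unit, and the only element of the group ring is a trivial unit.\<close>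
  proof (cases "\<one>\<^bsub>R\<^esub> = \<zero>\<^bsub>R\<^esub>")
    case True
    hence zero: "x = \<zero>\<^bsub>R\<^esub>" if "x \<in> carrier R" for x using that by (metis R.r_one R.r_null)
    have "u \<one> = \<one>\<^bsub>R\<^esub>"
      using zero[of "u \<one>"] True uC by simp
    hence "u \<one> \<in> Units R" by simp
    thus ?thesis
      using trivial_unit_if_unit_coeff_annihilates_rest[OF uC one_closed] orth[OF one_closed] by metis
  next
    case False
    let ?A = "supp R G u"
    have A: "finite ?A" "?A \<subseteq> carrier G"
      using finite_supp[OF uC] supp_subset by simp_all
    hence AG: "\<alpha> \<in> carrier G" if "\<alpha> \<in> ?A" for \<alpha> using that by blast
    define f where "f \<alpha> = c \<alpha> (inv \<alpha>) \<otimes>\<^bsub>R\<^esub> u \<alpha> \<otimes>\<^bsub>R\<^esub> v (inv \<alpha>)" for \<alpha>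
    have fC: "f \<in> ?A \<rightarrow> carrier R" using uC v AG by (auto simp: f_def)
    have "(\<Oplus>\<^bsub>R\<^esub>\<alpha>\<in>?A. f \<alpha>) = (\<Oplus>\<^bsub>R\<^esub>\<alpha>\<in>?A. c \<alpha> (inv \<alpha> \<otimes> \<one>) \<otimes>\<^bsub>R\<^esub> u \<alpha> \<otimes>\<^bsub>R\<^esub> v (inv \<alpha> \<otimes> \<one>))"
      using uC v AG by (intro R.finsum_cong') (auto simp: f_def)
    also have "\<dots> = (u \<otimes>\<^bsub>T\<^esub> v) \<one>"
      using uC v A by (simp add: mult_apply[where A = ?A])
    also have "\<dots> = \<one>\<^bsub>R\<^esub>" by (simp add: uv one_T)
    finally have sum: "(\<Oplus>\<^bsub>R\<^esub>\<alpha>\<in>?A. f \<alpha>) = \<one>\<^bsub>R\<^esub>" .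
    have "f i \<otimes>\<^bsub>R\<^esub> f j = \<zero>\<^bsub>R\<^esub>" if ij: "i \<in> ?A" "j \<in> ?A" "i \<noteq> j" for i j
    proof -
      have "f i \<otimes>\<^bsub>R\<^esub> f j = (u i \<otimes>\<^bsub>R\<^esub> u j) \<otimes>\<^bsub>R\<^esub>
          (c i (inv i) \<otimes>\<^bsub>R\<^esub> v (inv i) \<otimes>\<^bsub>R\<^esub> (c j (inv j) \<otimes>\<^bsub>R\<^esub> v (inv j)))"
        using uC v AG[OF ij(1)] AG[OF ij(2)] by (simp add: f_def R.m_ac)
      thus ?thesis using orth ij uC v AG[OF ij(1)] AG[OF ij(2)] by simp
    qed
    then obtain \<alpha> where \<alpha>: "\<alpha> \<in> ?A" "f \<alpha> = \<one>\<^bsub>R\<^esub>"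
      using R.orthogonal_sum_one_indecomposable[OF ind A(1) fC sum False] by blast
    note \<alpha>G = AG[OF \<alpha>(1)]
    have "u \<alpha> \<otimes>\<^bsub>R\<^esub> (c \<alpha> (inv \<alpha>) \<otimes>\<^bsub>R\<^esub> v (inv \<alpha>)) = \<one>\<^bsub>R\<^esub>"
      using \<alpha>(2) uC v \<alpha>G by (simp add: f_def R.m_ac)
    hence "u \<alpha> \<in> Units R"
      using uC v \<alpha>G R.m_comm unfolding Units_def
      by (intro CollectI conjI bexI[of _ "c \<alpha> (inv \<alpha>) \<otimes>\<^bsub>R\<^esub> v (inv \<alpha>)"]) auto
    thus ?thesis
      using trivial_unit_if_unit_coeff_annihilates_rest[OF uC \<alpha>G] orth[OF \<alpha>G] by metis
  qed
qed

section \<open>Unique products\<close>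

text \<open>
  By cancellation, two factorisations of the same element agree as soon as their left factors do, so
  comparing left factors suffices to express uniqueness.
\<close>

lemma (in group) unique_product_propertyD:
  assumes "unique_product_property G"
    and "finite A" "A \<noteq> {}" "A \<subseteq> carrier G" "finite B" "B \<noteq> {}" "B \<subseteq> carrier G"
  shows "\<exists>a\<in>A. \<exists>b\<in>B. \<forall>a'\<in>A. \<forall>b'\<in>B. a' \<otimes> b' = a \<otimes> b \<longrightarrow> a' = a"
proof -
  have "\<exists>x \<in> A <#> B. \<exists>!p. p \<in> A \<times> B \<and> x = fst p \<otimes> snd p"
    using assms(1)[unfolded unique_product_property_def, rule_format, of A B] assms(2-7) by simp
  then obtain x where "\<exists>!p. p \<in> A \<times> B \<and> x = fst p \<otimes> snd p" ..
  then obtain p where p: "p \<in> A \<times> B" "x = fst p \<otimes> snd p"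
    and uniq: "\<forall>q. q \<in> A \<times> B \<and> x = fst q \<otimes> snd q \<longrightarrow> q = p"
    by (rule ex1E) blast
  have "a' = fst p" if "a' \<in> A" "b' \<in> B" "a' \<otimes> b' = fst p \<otimes> snd p" for a' b'
    using uniq[rule_format, of "(a', b')"] that p(2) by auto
  thus ?thesis
    using p(1) by (intro bexI[of _ "fst p"] bexI[of _ "snd p"] ballI impI) auto
qed

text \<open>
  Strojnowski's argument. If no pair but \<open>(\<one>, \<one>)\<close> has a product that arises only once, consider
  \<open>C = B\<^sup>-\<^sup>1 A\<close> and \<open>D = B A\<^sup>-\<^sup>1\<close>. In an element \<open>(b\<^sub>1\<^sup>-\<^sup>1 a\<^sub>1) (b\<^sub>2 a\<^sub>2\<^sup>-\<^sup>1)\<close> of \<open>C D\<close> the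
  inner product \<open>a\<^sub>1 b\<^sub>2\<close> can be rewritten unless \<open>a\<^sub>1 = b\<^sub>2 = \<one>\<close>; then the element is
  \<open>(a\<^sub>2 b\<^sub>1)\<^sup>-\<^sup>1\<close>, which can be rewritten unless \<open>a\<^sub>2 = b\<^sub>1 = \<one>\<close>; and \<open>\<one>\<close> equals
  \<open>(\<one>\<^sup>-\<^sup>1 a) (\<one> a\<^sup>-\<^sup>1)\<close> for every \<open>a \<in> A\<close>. So if \<open>A \<noteq> {\<one>}\<close>, no product in \<open>C D\<close> arises only once.
\<close>

lemma (in group) unique_product_only_at_one:
  assumes upp: "unique_product_property G"
    and A: "finite A" "\<one> \<in> A" "A \<subseteq> carrier G" and B: "finite B" "\<one> \<in> B" "B \<subseteq> carrier G"
    and only: "\<And>a b. a \<in> A \<Longrightarrow> b \<in> B \<Longrightarrow> (a, b) \<noteq> (\<one>, \<one>) \<Longrightarrow>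
                 \<exists>a'\<in>A. \<exists>b'\<in>B. a' \<otimes> b' = a \<otimes> b \<and> a' \<noteq> a"
  shows "A = {\<one>}"
proof (rule ccontr)
  assume "A \<noteq> {\<one>}"
  then obtain a0 where a0: "a0 \<in> A" "a0 \<noteq> \<one>" using A(2) by blast
  define C where "C = (\<lambda>(b, a). inv b \<otimes> a) ` (B \<times> A)"
  define D where "D = (\<lambda>(b, a). b \<otimes> inv a) ` (B \<times> A)"
  have CI: "inv b \<otimes> a \<in> C" and DI: "b \<otimes> inv a \<in> D" if "a \<in> A" "b \<in> B" for a b
    using that by (auto simp: C_def D_def)
  have "finite C" "C \<noteq> {}" "C \<subseteq> carrier G" "finite D" "D \<noteq> {}" "D \<subseteq> carrier G"
    using A B by (auto simp: C_def D_def)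
  from unique_product_propertyD[OF upp this]
  obtain x y where x: "x \<in> C" and y: "y \<in> D"
    and uniq: "\<And>x' y'. x' \<in> C \<Longrightarrow> y' \<in> D \<Longrightarrow> x' \<otimes> y' = x \<otimes> y \<Longrightarrow> x' = x" by blast
  from x obtain b1 a1 where 1: "b1 \<in> B" "a1 \<in> A" "x = inv b1 \<otimes> a1" by (auto simp: C_def)
  from y obtain b2 a2 where 2: "b2 \<in> B" "a2 \<in> A" "y = b2 \<otimes> inv a2" by (auto simp: D_def)
  have car: "a \<in> A \<Longrightarrow> a \<in> carrier G" "b \<in> B \<Longrightarrow> b \<in> carrier G" for a b using A B by auto
  have mid: "(inv b \<otimes> a) \<otimes> (b' \<otimes> inv a') = inv b \<otimes> (a \<otimes> b') \<otimes> inv a'"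
    if "a \<in> A" "b \<in> B" "a' \<in> A" "b' \<in> B" for a b a' b'
    using that car by (simp add: m_assoc)
  \<comment> \<open>Another factorisation of \<open>a1 \<otimes> b2\<close> would give another factorisation of \<open>x \<otimes> y\<close>.\<close>
  have inner: "(a1, b2) = (\<one>, \<one>)"
  proof (rule ccontr)
    assume "(a1, b2) \<noteq> (\<one>, \<one>)"
    then obtain a b where ab: "a \<in> A" "b \<in> B" "a \<otimes> b = a1 \<otimes> b2" "a \<noteq> a1"
      using only 1 2 by blast
    have "inv b1 \<otimes> a = x"
    proof (rule uniq[OF CI[OF ab(1) 1(1)] DI[OF 2(2) ab(2)]])
      show "(inv b1 \<otimes> a) \<otimes> (b \<otimes> inv a2) = x \<otimes> y"
        using mid ab 1 2 by simp
    qed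
    thus False using ab 1 car by simp
  qed
  hence xy: "x = inv b1" "y = inv a2" using 1 2 car by auto
  \<comment> \<open>Now \<open>x \<otimes> y\<close> is the inverse of \<open>a2 \<otimes> b1\<close>, and another factorisation of that gives one of \<open>x \<otimes> y\<close>.\<close>
  have outer: "(a2, b1) = (\<one>, \<one>)"
  proof (rule ccontr)
    assume "(a2, b1) \<noteq> (\<one>, \<one>)"
    then obtain a b where ab: "a \<in> A" "b \<in> B" "a \<otimes> b = a2 \<otimes> b1" "a \<noteq> a2"
      using only 1 2 by blast
    have "inv b \<otimes> \<one> = x"
    proof (rule uniq[OF CI[OF A(2) ab(2)] DI[OF ab(1) B(2)]])
      show "(inv b \<otimes> \<one>) \<otimes> (\<one> \<otimes> inv a) = x \<otimes> y"
        using ab 1 2 car by (simp add: xy inv_mult_group[symmetric])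
    qed
    hence "b = b1" using ab 1 car xy by (metis inv_closed inv_inv r_one)
    thus False using ab 1 2 car by auto
  qed
  hence xy1: "x = \<one>" "y = \<one>" using xy by auto
  have "inv \<one> \<otimes> a0 = x"
    using a0 car xy1 by (intro uniq[OF CI[OF a0(1) B(2)] DI[OF a0(1) B(2)]]) simp
  thus False using a0 car xy1 by simp
qed

text \<open>
  The translates \<open>a\<^sub>0\<^sup>-\<^sup>1 A\<close> and \<open>B b\<^sub>0\<^sup>-\<^sup>1\<close> move the exceptional pair to \<open>(\<one>, \<one>)\<close> and preserve the
  coincidences between products.
\<close>

lemma (in group) two_unique_products:
  assumes upp: "unique_product_property G"
    and A: "finite A" "A \<subseteq> carrier G" and B: "finite B" "B \<subseteq> carrier G"
    and a0: "a0 \<in> A" and b0: "b0 \<in> B"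
    and only: "\<And>a b. a \<in> A \<Longrightarrow> b \<in> B \<Longrightarrow> (a, b) \<noteq> (a0, b0) \<Longrightarrow>
                 \<exists>a'\<in>A. \<exists>b'\<in>B. a' \<otimes> b' = a \<otimes> b \<and> a' \<noteq> a"
  shows "A = {a0}"
proof -
  let ?A = "(\<lambda>a. inv a0 \<otimes> a) ` A" and ?B = "(\<lambda>b. b \<otimes> inv b0) ` B"
  have car: "a \<in> A \<Longrightarrow> a \<in> carrier G" "b \<in> B \<Longrightarrow> b \<in> carrier G" for a b using A B by auto
  have c0: "a0 \<in> carrier G" "b0 \<in> carrier G" using car a0 b0 by auto
  have "?A = {\<one>}"
  proof (rule unique_product_only_at_one[OF upp, of ?A ?B])
    show "finite ?A" "finite ?B" using A B by auto
    show "\<one> \<in> ?A" using a0 c0 by (force intro: image_eqI[of _ _ a0])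
    show "\<one> \<in> ?B" using b0 c0 by (force intro: image_eqI[of _ _ b0])
    show "?A \<subseteq> carrier G" "?B \<subseteq> carrier G" using car c0 by auto
  next
    fix x y assume "x \<in> ?A" "y \<in> ?B" and ne: "(x, y) \<noteq> (\<one>, \<one>)"
    then obtain a b where ab: "a \<in> A" "x = inv a0 \<otimes> a" "b \<in> B" "y = b \<otimes> inv b0" by blast
    have "(a, b) \<noteq> (a0, b0)" using ne ab c0 by auto
    then obtain a' b' where ab': "a' \<in> A" "b' \<in> B" "a' \<otimes> b' = a \<otimes> b" "a' \<noteq> a"
      using only ab by blast
    have "(inv a0 \<otimes> p) \<otimes> (q \<otimes> inv b0) = inv a0 \<otimes> (p \<otimes> q) \<otimes> inv b0"
      if "p \<in> A" "q \<in> B" for p q using that car c0 by (simp add: m_assoc)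
    hence "(inv a0 \<otimes> a') \<otimes> (b' \<otimes> inv b0) = x \<otimes> y" "inv a0 \<otimes> a' \<noteq> x"
      using ab ab' car c0 by auto
    thus "\<exists>x'\<in>?A. \<exists>y'\<in>?B. x' \<otimes> y' = x \<otimes> y \<and> x' \<noteq> x"
      using ab' by blast
  qed
  hence "inv a0 \<otimes> a = \<one>" if "a \<in> A" for a using that by blast
  hence "a = a0" if "a \<in> A" for a
    using that car c0 by (metis inv_closed inv_equality inv_inv)
  thus ?thesis using a0 by blast
qed

lemma (in twisted_group) mult_apply_unique_product:
  assumes f: "f \<in> carrier T" and h: "h \<in> carrier T"
    and a: "a \<in> supp R G f" and b: "b \<in> supp R G h"
    and uniq: "\<And>a' b'. a' \<in> supp R G f \<Longrightarrow> b' \<in> supp R G h \<Longrightarrow> a' \<otimes> b' = a \<otimes> b \<Longrightarrow> a' = a"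
  shows "(f \<otimes>\<^bsub>T\<^esub> h) (a \<otimes> b) = c a b \<otimes>\<^bsub>R\<^esub> f a \<otimes>\<^bsub>R\<^esub> h b"
proof -
  let ?A = "supp R G f"
  have A: "finite ?A" "?A \<subseteq> carrier G"
    using finite_supp[OF f] supp_subset by simp_all
  hence AG: "\<alpha> \<in> carrier G" if "\<alpha> \<in> ?A" for \<alpha> using that by blast
  have ab: "a \<in> carrier G" "b \<in> carrier G" using a b by (simp_all add: supp_def)
  have other: "h (inv \<alpha> \<otimes> (a \<otimes> b)) = \<zero>\<^bsub>R\<^esub>" if "\<alpha> \<in> ?A" "\<alpha> \<noteq> a" for \<alpha>
  proof (rule ccontr)
    assume "h (inv \<alpha> \<otimes> (a \<otimes> b)) \<noteq> \<zero>\<^bsub>R\<^esub>"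
    hence "inv \<alpha> \<otimes> (a \<otimes> b) \<in> supp R G h"
      using AG[OF that(1)] ab by (simp add: supp_def)
    moreover have "\<alpha> \<otimes> (inv \<alpha> \<otimes> (a \<otimes> b)) = a \<otimes> b"
      using AG[OF that(1)] ab by (simp add: m_assoc[symmetric])
    ultimately show False using uniq[OF that(1)] that(2) by simp
  qed
  have ib: "inv a \<otimes> (a \<otimes> b) = b" using ab by (simp add: m_assoc[symmetric])
  have "(f \<otimes>\<^bsub>T\<^esub> h) (a \<otimes> b) =
      (\<Oplus>\<^bsub>R\<^esub>\<alpha>\<in>?A. c \<alpha> (inv \<alpha> \<otimes> (a \<otimes> b)) \<otimes>\<^bsub>R\<^esub> f \<alpha> \<otimes>\<^bsub>R\<^esub> h (inv \<alpha> \<otimes> (a \<otimes> b)))"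
    using ab by (intro mult_apply[OF f h _ A(1) order_refl A(2)]) simp
  also have "\<dots> = (\<Oplus>\<^bsub>R\<^esub>\<alpha>\<in>?A. if a = \<alpha> then c a b \<otimes>\<^bsub>R\<^esub> f a \<otimes>\<^bsub>R\<^esub> h b else \<zero>\<^bsub>R\<^esub>)"
    using f h ab AG other ib by (intro R.finsum_cong') auto
  also have "\<dots> = c a b \<otimes>\<^bsub>R\<^esub> f a \<otimes>\<^bsub>R\<^esub> h b"
    using R.finsum_singleton[OF a A(1), of "\<lambda>_. c a b \<otimes>\<^bsub>R\<^esub> f a \<otimes>\<^bsub>R\<^esub> h b"] f h ab by simp
  finally show ?thesis .
qed

text \<open>
  A product \<open>a b\<close> of support elements that arises only once has a nonzero coefficient in
  \<open>u v = \<delta>\<^sub>e\<close>, so it is \<open>\<one>\<close>. Two such pairs would then have the same product and thus coincide, which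
  leaves a single exceptional pair.
\<close>

lemma (in group) unique_product_imp_no_nontrivial_units:
  assumes upp: "unique_product_property G" and "field k" and c: "normalised_cocycle k G c"
  shows "no_nontrivial_units k G c"
proof -
  interpret k: field k by fact
  interpret twisted_group G k c by unfold_locales fact
  show ?thesis
    unfolding no_nontrivial_units_def
  proof
    fix u assume "u \<in> Units T"
    then obtain v where u: "u \<in> carrier T" and v: "v \<in> carrier T" and uv: "u \<otimes>\<^bsub>T\<^esub> v = \<one>\<^bsub>T\<^esub>"
      by (auto simp: Units_T_iff)
    let ?A = "supp k G u" and ?B = "supp k G v"
    have A: "finite ?A" "?A \<subseteq> carrier G" and B: "finite ?B" "?B \<subseteq> carrier G"
      using finite_supp[OF u] finite_supp[OF v] supp_subset by simp_all
    have uv1: "(u \<otimes>\<^bsub>T\<^esub> v) \<one> = \<one>\<^bsub>k\<^esub>" by (simp add: uv one_T)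
    have ne: "?A \<noteq> {}" "?B \<noteq> {}"
    proof -
      show "?A \<noteq> {}"
      proof
        assume "?A = {}"
        thus False using uv1 by (simp add: twisted_group_ring_def)
      qed
      show "?B \<noteq> {}"
      proof
        assume "?B = {}"
        hence "v x = \<zero>\<^bsub>k\<^esub>" if "x \<in> carrier G" for x using that by (auto simp: supp_def)
        hence "(u \<otimes>\<^bsub>T\<^esub> v) \<one> = \<zero>\<^bsub>k\<^esub>"
          using u v A by (simp add: mult_apply[where A = ?A] subset_iff k.add.finprod_one_eqI)
        thus False using uv1 by simp
      qed
    qed
    have at_one: "a \<otimes> b = \<one>" if ab: "a \<in> ?A" "b \<in> ?B"
      and uniq: "\<And>a' b'. a' \<in> ?A \<Longrightarrow> b' \<in> ?B \<Longrightarrow> a' \<otimes> b' = a \<otimes> b \<Longrightarrow> a' = a" for a b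
    proof (rule ccontr)
      assume "a \<otimes> b \<noteq> \<one>"
      have G: "a \<in> carrier G" "b \<in> carrier G" and nz: "u a \<noteq> \<zero>\<^bsub>k\<^esub>" "v b \<noteq> \<zero>\<^bsub>k\<^esub>"
        using ab by (auto simp: supp_def)
      have "c a b \<otimes>\<^bsub>k\<^esub> u a \<otimes>\<^bsub>k\<^esub> v b = \<zero>\<^bsub>k\<^esub>"
        using mult_apply_unique_product[OF u v ab uniq] \<open>a \<otimes> b \<noteq> \<one>\<close> G by (simp add: uv one_T)
      moreover have "c a b \<noteq> \<zero>\<^bsub>k\<^esub>" using c_unit[OF G] by (simp add: k.field_Units)
      ultimately show False using G u v nz by (simp add: k.integral_iff)
    qed
    obtain a0 b0 where ab0: "a0 \<in> ?A" "b0 \<in> ?B"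
      and uniq: "\<And>a' b'. a' \<in> ?A \<Longrightarrow> b' \<in> ?B \<Longrightarrow> a' \<otimes> b' = a0 \<otimes> b0 \<Longrightarrow> a' = a0"
      using unique_product_propertyD[OF upp A(1) ne(1) A(2) B(1) ne(2) B(2)] by blast
    have one0: "a0 \<otimes> b0 = \<one>" by (rule at_one[OF ab0 uniq])
    have "?A = {a0}"
    proof (rule two_unique_products[OF upp A B ab0])
      fix a b assume ab: "a \<in> ?A" "b \<in> ?B" "(a, b) \<noteq> (a0, b0)"
      show "\<exists>a'\<in>?A. \<exists>b'\<in>?B. a' \<otimes> b' = a \<otimes> b \<and> a' \<noteq> a"
      proof (rule ccontr)
        assume "\<not> ?thesis"
        hence "a \<otimes> b = \<one>" using at_one[OF ab(1,2)] by blast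
        moreover from this have "a = a0" using uniq ab one0 by simp
        ultimately have "a0 \<otimes> b = a0 \<otimes> b0" using one0 by simp
        moreover have "b \<in> carrier G" "b0 \<in> carrier G" "a0 \<in> carrier G"
          using ab ab0 A B by auto
        ultimately show False using ab \<open>a = a0\<close> by simp
      qed
    qed
    hence a0: "a0 \<in> carrier G" "u a0 \<noteq> \<zero>\<^bsub>k\<^esub>"
      and zero: "\<And>x. x \<in> carrier G \<Longrightarrow> x \<noteq> a0 \<Longrightarrow> u x = \<zero>\<^bsub>k\<^esub>"
      by (auto simp: supp_def)
    have "u a0 \<in> Units k" using a0 u by (simp add: k.field_Units)
    thus "u \<in> trivial_units k G"
      using a0(1) u zero by (intro trivial_unit_if_unit_coeff_annihilates_rest[of u a0]) simp_all
  qed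
qed

section \<open>Trivial units over commutative rings\<close>

theorem proposition9p2:
  fixes G :: "('g, 'n) monoid_scheme" and R :: "('r, 'm) ring_scheme"
    and c :: "'g \<Rightarrow> 'g \<Rightarrow> 'r"
  assumes "group G" and "carrier G \<noteq> {\<one>\<^bsub>G\<^esub>}"
    and "cring R" and "normalised_cocycle R G c"
  shows "(trivial_units_only G \<longrightarrow>
            (no_nontrivial_units R G c \<longleftrightarrow> reduced_ring R \<and> indecomposable_ring R)) \<and>
         (unique_product_property G \<longrightarrow> trivial_units_only G)"
proof -
  interpret group G by fact
  interpret R: cring R by fact
  interpret twisted_group G R c by unfold_locales fact
  show ?thesis
    using assms(1,2) no_nontrivial_units_imp_reduced no_nontrivial_units_imp_indecomposable
      reduced_indecomposable_imp_no_nontrivial_units unique_product_imp_no_nontrivial_units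
    unfolding trivial_units_only_def by blast
qed

end
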